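(* Let $\mathcal{S}=\{S_1,\dots,S_k\}$ be a family of sets with total size $\sum_i |S_i|$ and consider the set intersection problem: preprocess $\mathcal{S}$ so that, given $i,j$, one can decide whether $S_i\cap S_j=\emptyset$. Suppose there is a data structure for tree-tree LCE queries $\mathrm{LCE}_{TT}$ on edge-labeled rooted trees with $n$ nodes that uses $s(n)$ space and answers queries in $q(n)$ time. Then one can build a set intersection data structure using $O(s(n))$ space and $O(q(n))$ query time for input families whose sets contain $O(n)$ elements in total.
   Context: For a node $v$ and a descendant $w$ of $v$, $v\leadsto w$ is the downward path with string the concatenation of its edge labels (one character per edge) from top to bottom. The path-path LCE of two downward paths is their longest pair of path prefixes with equal strings. $\mathrm{LCE}_{TT}(v_1,v_2)$ returns a maximal path-path LCE of any pair of paths from $v_1$ and from $v_2$ to descendant leaves of $v_1$ and $v_2$ respectively. *)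

theory Defs
  imports Complex_Main "HOL-Library.Landau_Symbols"
begin

section \<open>Word RAM\<close>

text \<open>
  Query algorithms are structured programs of a unit-cost word RAM. A machine state consists of
  registers, holding the constantly many local variables of a program, and of a random access
  memory of fixed length, the space occupied by the data structure including any scratch space.
  The parameter \<open>B\<close> of the semantics bounds the numbers that fit into a word. An operation whose
  result does not fit, or an access outside the memory, has no derivation, so a query that
  performs one is not accepted. Wrap-around arithmetic can be programmed with \<open>Mod\<close>, as \<open>B\<close> will be
  an arbitrary polynomial in the input size, that is, words have \<open>O(log n)\<close> bits.
\<close>

datatype binop = Add | Sub | Mul | Div | Mod | BAnd | BOr | BXor | Shl | Shr | Less | Equal

fun eval_binop :: "binop \<Rightarrow> nat \<Rightarrow> nat \<Rightarrow> nat" where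
  "eval_binop Add a b = a + b"
| "eval_binop Sub a b = a - b"
| "eval_binop Mul a b = a * b"
| "eval_binop Div a b = a div b"
| "eval_binop Mod a b = a mod b"
| "eval_binop BAnd a b = and a b"
| "eval_binop BOr a b = or a b"
| "eval_binop BXor a b = xor a b"
| "eval_binop Shl a b = push_bit b a"
| "eval_binop Shr a b = drop_bit b a"
| "eval_binop Less a b = of_bool (a < b)"
| "eval_binop Equal a b = of_bool (a = b)"

type_synonym reg = nat

datatype prog =
    Skip
  | Const reg nat
  | Op binop reg reg reg
  | Load reg reg
  | Store reg reg
  | Seq prog prog
  | If reg prog prog
  | While reg prog

type_synonym state = "(reg \<Rightarrow> nat) \<times> nat list"

text \<open>\<open>exec B p st t st'\<close>: started in \<open>st\<close>, program \<open>p\<close> halts in \<open>st'\<close> after \<open>t\<close> steps.\<close>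

inductive exec :: "nat \<Rightarrow> prog \<Rightarrow> state \<Rightarrow> nat \<Rightarrow> state \<Rightarrow> bool" for B :: nat where
  Skip: "exec B Skip st 1 st"
| Const: "a < B \<Longrightarrow> exec B (Const x a) (rs, M) 1 (rs(x := a), M)"
| Op: "eval_binop f (rs y) (rs z) < B \<Longrightarrow>
    exec B (Op f x y z) (rs, M) 1 (rs(x := eval_binop f (rs y) (rs z)), M)"
| Load: "rs y < length M \<Longrightarrow> exec B (Load x y) (rs, M) 1 (rs(x := M ! rs y), M)"
| Store: "rs x < length M \<Longrightarrow> exec B (Store x y) (rs, M) 1 (rs, M[rs x := rs y])"
| Seq: "exec B p st t st' \<Longrightarrow> exec B p' st' t' st'' \<Longrightarrow> exec B (Seq p p') st (t + t') st''"
| If_True: "rs x \<noteq> 0 \<Longrightarrow> exec B p (rs, M) t st' \<Longrightarrow> exec B (If x p p') (rs, M) (1 + t) st'"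
| If_False: "rs x = 0 \<Longrightarrow> exec B p' (rs, M) t st' \<Longrightarrow> exec B (If x p p') (rs, M) (1 + t) st'"
| While_True: "rs x \<noteq> 0 \<Longrightarrow> exec B p (rs, M) t st' \<Longrightarrow> exec B (While x p) st' t' st'' \<Longrightarrow>
    exec B (While x p) (rs, M) (1 + t + t') st''"
| While_False: "rs x = 0 \<Longrightarrow> exec B (While x p) (rs, M) 1 (rs, M)"

section \<open>Data structures\<close>

text \<open>
  \<open>R\<close> is the set of memory contents that represent one preprocessed input. A query \<open>(a, b) \<in> Q\<close> is
  passed in registers 0 and 1, the other registers being 0, and is answered in registers 0 and 1;
  \<open>ans a b x y\<close> says that \<open>(x, y)\<close> is a correct answer. A query may write to the memory but has to
  leave it in a state that again represents the input, so that any sequence of queries can be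
  answered. The content of \<open>R\<close> is not constrained otherwise: preprocessing is not charged for.
\<close>

definition answers_queries ::
  "nat \<Rightarrow> prog \<Rightarrow> nat list set \<Rightarrow> (nat \<times> nat) set \<Rightarrow> (nat \<Rightarrow> nat \<Rightarrow> nat \<Rightarrow> nat \<Rightarrow> bool)
    \<Rightarrow> real \<Rightarrow> real \<Rightarrow> bool" where
  "answers_queries B p R Q ans space time \<longleftrightarrow>
     R \<noteq> {} \<and>
     (\<forall>M\<in>R. real (length M) \<le> space \<and> length M \<le> B \<and> (\<forall>x\<in>set M. x < B) \<and>
       (\<forall>(a, b)\<in>Q. \<exists>t rs M'.
          exec B p ((\<lambda>_. 0)(0 := a, 1 := b), M) t (rs, M') \<and>
          real t \<le> time \<and> M' \<in> R \<and> ans a b (rs 0) (rs 1)))"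

text \<open>The shift by 2 makes the bound at least 2 even for tiny \<open>n\<close> (if \<open>d > 0\<close>).\<close>

definition word_bound :: "nat \<Rightarrow> nat \<Rightarrow> nat" where
  "word_bound d n = (n + 2) ^ d"

section \<open>Edge-labeled rooted trees\<close>

text \<open>
  The nodes are \<open>0, \<dots>, nnodes T - 1\<close>. For a node \<open>v\<close> other than the root, \<open>edge_label T v\<close> is the
  label of the edge from \<open>parent T v\<close> to \<open>v\<close>; the values at the root and at non-nodes are
  irrelevant. Edges to different children of a node may have the same label.
\<close>

record 'a ltree =
  nnodes :: nat
  rootnode :: nat
  parent :: "nat \<Rightarrow> nat"
  edge_label :: "nat \<Rightarrow> 'a"

definition is_child :: "'a ltree \<Rightarrow> nat \<Rightarrow> nat \<Rightarrow> bool" where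
  "is_child T u v \<longleftrightarrow> v < nnodes T \<and> v \<noteq> rootnode T \<and> parent T v = u"

definition is_ltree :: "'a ltree \<Rightarrow> bool" where
  "is_ltree T \<longleftrightarrow> rootnode T < nnodes T \<and>
     (\<forall>v < nnodes T. v \<noteq> rootnode T \<longrightarrow> parent T v < nnodes T) \<and>
     (\<forall>v < nnodes T. (is_child T)\<^sup>*\<^sup>* (rootnode T) v)"

text \<open>\<open>downpath T v xs w\<close>: the downward path from \<open>v\<close> to \<open>w\<close> exists and has string \<open>xs\<close>.\<close>

inductive downpath :: "'a ltree \<Rightarrow> nat \<Rightarrow> 'a list \<Rightarrow> nat \<Rightarrow> bool" for T :: "'a ltree" where
  Nil: "v < nnodes T \<Longrightarrow> downpath T v [] v"
| Cons: "is_child T v u \<Longrightarrow> downpath T u xs w \<Longrightarrow> downpath T v (edge_label T u # xs) w"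

definition descendant :: "'a ltree \<Rightarrow> nat \<Rightarrow> nat \<Rightarrow> bool" where
  "descendant T v w \<longleftrightarrow> (\<exists>xs. downpath T v xs w)"

definition descendant_leaf :: "'a ltree \<Rightarrow> nat \<Rightarrow> nat \<Rightarrow> bool" where
  "descendant_leaf T v w \<longleftrightarrow> descendant T v w \<and> (\<forall>u. \<not> is_child T w u)"

section \<open>Longest common extensions\<close>

text \<open>
  A prefix of the path from \<open>v\<close> to \<open>w\<close> is given by its lower end, a node \<open>u\<close> on that path. Below,
  \<open>xs\<close> is the common string of the prefixes ending in \<open>u1\<close> and \<open>u2\<close>.
\<close>

definition equal_prefixes ::
  "'a ltree \<Rightarrow> nat \<Rightarrow> nat \<Rightarrow> nat \<Rightarrow> nat \<Rightarrow> 'a list \<Rightarrow> nat \<Rightarrow> nat \<Rightarrow> bool" where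
  "equal_prefixes T v1 w1 v2 w2 xs u1 u2 \<longleftrightarrow>
     downpath T v1 xs u1 \<and> descendant T u1 w1 \<and>
     downpath T v2 xs u2 \<and> descendant T u2 w2"

definition is_LCE_PP ::
  "'a ltree \<Rightarrow> nat \<Rightarrow> nat \<Rightarrow> nat \<Rightarrow> nat \<Rightarrow> 'a list \<Rightarrow> nat \<Rightarrow> nat \<Rightarrow> bool" where
  "is_LCE_PP T v1 w1 v2 w2 xs u1 u2 \<longleftrightarrow>
     equal_prefixes T v1 w1 v2 w2 xs u1 u2 \<and>
     (\<forall>ys x1 x2. equal_prefixes T v1 w1 v2 w2 ys x1 x2 \<longrightarrow> length ys \<le> length xs)"

definition is_LCE_TT :: "'a ltree \<Rightarrow> nat \<Rightarrow> nat \<Rightarrow> 'a list \<Rightarrow> nat \<Rightarrow> nat \<Rightarrow> bool" where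
  "is_LCE_TT T v1 v2 xs u1 u2 \<longleftrightarrow>
     (\<exists>w1 w2. descendant_leaf T v1 w1 \<and> descendant_leaf T v2 w2 \<and>
        is_LCE_PP T v1 w1 v2 w2 xs u1 u2) \<and>
     (\<forall>w1 w2 ys x1 x2. descendant_leaf T v1 w1 \<and> descendant_leaf T v2 w2 \<and>
        is_LCE_PP T v1 w1 v2 w2 ys x1 x2 \<longrightarrow> length ys \<le> length xs)"

section \<open>The two data structure problems\<close>

text \<open>
  One query program and one exponent for the word bound serve all input sizes. The type argument
  fixes the alphabet, respectively the universe of the sets. A tree-tree LCE is returned as the
  pair of lower ends of the two path prefixes.
\<close>

definition LCE_TT_data_structure ::
  "'a itself \<Rightarrow> (nat \<Rightarrow> real) \<Rightarrow> (nat \<Rightarrow> real) \<Rightarrow> bool" where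
  "LCE_TT_data_structure (_ :: 'a itself) s q \<longleftrightarrow>
     (\<exists>p d. \<forall>n. \<forall>T :: 'a ltree. is_ltree T \<and> nnodes T = n \<longrightarrow>
        (\<exists>R. answers_queries (word_bound d n) p R ({..<n} \<times> {..<n})
           (\<lambda>v1 v2 u1 u2. \<exists>xs. is_LCE_TT T v1 v2 xs u1 u2) (s n) (q n)))"

text \<open>
  The family is the list \<open>F\<close>, indexed from 0; repetitions and empty sets are allowed. Families with
  \<open>O(n)\<close> elements are those with at most \<open>c * n\<close> elements for a constant \<open>c\<close>. The bound on the
  number of sets only limits the number of empty sets, as it follows from the bound on the
  total size if all sets are nonempty; without it an index need not even fit into a word.
\<close>

definition set_intersection_data_structure ::
  "'a itself \<Rightarrow> nat \<Rightarrow> (nat \<Rightarrow> real) \<Rightarrow> (nat \<Rightarrow> real) \<Rightarrow> bool" where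
  "set_intersection_data_structure (_ :: 'a itself) c s q \<longleftrightarrow>
     (\<exists>p d. \<forall>n. \<forall>F :: 'a set list.
        (\<forall>S\<in>set F. finite S) \<and> (\<Sum>S\<leftarrow>F. card S) \<le> c * n \<and> length F \<le> c * n \<longrightarrow>
        (\<exists>R. answers_queries (word_bound d n) p R ({..<length F} \<times> {..<length F})
           (\<lambda>i j x _. x = of_bool (F ! i \<inter> F ! j = {})) (s n) (q n)))"

end

theory Submission imports Defs "HOL-Combinatorics.Permutations" begin

text \<open>
  Give every set \<open>S\<close> a node with one child per element of \<open>S\<close>, reached by an edge labelled with that
  element. The tree-tree LCE of two such nodes is empty iff the sets are disjoint.

  As nothing is assumed about the growth of \<open>s\<close>, the trees for size \<open>n\<close> need exactly \<open>n\<close> nodes. So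
  the pairs (set, element) are split into constantly many parts, there is one tree for any two
  parts, and a query asks all these trees. The nodes of a set in the trees are looked up in tables
  with \<open>O(n)\<close> entries. This fits into \<open>O(s(n))\<close> space because \<open>s(n)\<close> is at least linear: about
  \<open>(n/2)!\<close> trees are told apart by their queries, and a memory word has \<open>O(log n)\<close> bits.
\<close>

section \<open>Program execution\<close>

text \<open>Enlarging the tree by a constant factor is not possible, because
  \<open>s (C * n)\<close> need not be bounded by a multiple of \<open>s n\<close>. An element
  common to two sets contributes one incidence to each of them, and these may land in different
  parts; one tree for every ordered pair of parts catches all such coincidences. The number of parts
  depends on \<open>c\<close> only, so the query program can be an unrolled sequence of subqueries.

  A query returns two nodes and no length. In trees of this shape the LCE is empty iff the first
  returned node is the queried node itself, which is a constant-time test.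

  The given structures are black boxes that use absolute addresses and may rewrite their memories,
  so their common program has to be relocated, and only the lengths of the memories may be relied
  upon between queries.

  In the space bound the alphabet may consist of a single letter, so trees have to be distinguished
  by the returned nodes rather than by labels.\<close>

inductive_cases exec_SkipE: "exec B Skip st t st'"
inductive_cases exec_ConstE: "exec B (Const x a) st t st'"
inductive_cases exec_OpE: "exec B (Op f x y z) st t st'"
inductive_cases exec_LoadE: "exec B (Load x y) st t st'"
inductive_cases exec_StoreE: "exec B (Store x y) st t st'"
inductive_cases exec_SeqE: "exec B (Seq p p') st t st'"
inductive_cases exec_IfE: "exec B (If x p p') (rs, M) t st'"
inductive_cases exec_WhileE: "exec B (While x p) (rs, M) t st'"

text \<open>Serves the space bound: a memory content determines its answers, so it cannot represent
  two trees for which some query has no common correct answer.\<close>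

lemma exec_deterministic:
  assumes "exec B p st t st'" "exec B p st u st''"
  shows "t = u \<and> st' = st''"
  using assms
proof (induction arbitrary: u st'' rule: exec.induct)
  case (Skip st)
  then show ?case by (elim exec_SkipE) simp
next
  case (Const a x rs M)
  from Const.prems show ?case by (elim exec_ConstE) simp
next
  case (Op f rs y z x M)
  from Op.prems show ?case by (elim exec_OpE) simp
next
  case (Load rs y M x)
  from Load.prems show ?case by (elim exec_LoadE) simp
next
  case (Store rs x M y)
  from Store.prems show ?case by (elim exec_StoreE) simp
next
  case (Seq p st t st1 p' t' st2)
  from Seq.prems obtain v v' st3 where *: "u = v + v'" "exec B p st v st3" "exec B p' st3 v' st''"
    by (elim exec_SeqE) metis
  show ?case using Seq.IH(1)[OF *(2)] Seq.IH(2)[of v' st''] * by simp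
next
  case (If_True rs x p M t st' p')
  from If_True.prems If_True.hyps obtain v where "u = 1 + v" "exec B p (rs, M) v st''"
    by (elim exec_IfE) simp_all
  with If_True.IH show ?case by simp
next
  case (If_False rs x p' M t st' p)
  from If_False.prems If_False.hyps obtain v where "u = 1 + v" "exec B p' (rs, M) v st''"
    by (elim exec_IfE) simp_all
  with If_False.IH show ?case by simp
next
  case (While_True rs x p M t st1 t' st2)
  from While_True.prems While_True.hyps(1) obtain v v' st3 where
    *: "u = 1 + v + v'" "exec B p (rs, M) v st3" "exec B (While x p) st3 v' st''"
    by (elim exec_WhileE) simp_all
  show ?case using While_True.IH(1)[OF *(2)] While_True.IH(2)[of v' st''] * by simp
next
  case (While_False rs x p M)
  from While_False.prems While_False.hyps show ?case by (elim exec_WhileE) simp_all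
qed

text \<open>Keeps the offsets of memories laid end to end valid although queries write to
  them.\<close>

lemma exec_length: "exec B p st t st' \<Longrightarrow> length (snd st') = length (snd st)"
  by (induction rule: exec.induct) auto

lemma exec_time_pos: "exec B p st t st' \<Longrightarrow> 1 \<le> t"
  by (induction rule: exec.induct) auto

section \<open>Relocating a program inside a larger memory\<close>

primrec regs :: "prog \<Rightarrow> reg set" where
  "regs Skip = {}"
| "regs (Const x a) = {x}"
| "regs (Op f x y z) = {x, y, z}"
| "regs (Load x y) = {x, y}"
| "regs (Store x y) = {x, y}"
| "regs (Seq p p') = regs p \<union> regs p'"
| "regs (If x p p') = insert x (regs p \<union> regs p')"
| "regs (While x p) = insert x (regs p)"

lemma finite_regs: "finite (regs p)"
  by (induction p) auto

text \<open>Register \<open>b\<close> holds the offset at which the memory of \<open>p\<close> starts; \<open>Suc b\<close> is scratch.\<close>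

primrec reloc :: "reg \<Rightarrow> prog \<Rightarrow> prog" where
  "reloc b Skip = Skip"
| "reloc b (Const x a) = Const x a"
| "reloc b (Op f x y z) = Op f x y z"
| "reloc b (Load x y) = Seq (Op Add (Suc b) b y) (Load x (Suc b))"
| "reloc b (Store x y) = Seq (Op Add (Suc b) b x) (Store (Suc b) y)"
| "reloc b (Seq p p') = Seq (reloc b p) (reloc b p')"
| "reloc b (If x p p') = If x (reloc b p) (reloc b p')"
| "reloc b (While x p) = While x (reloc b p)"

lemma exec_witness:
  "exec B p st t (rs, M) \<Longrightarrow> t \<le> u \<Longrightarrow> P rs \<Longrightarrow> Q rs \<Longrightarrow>
    \<exists>t rs. exec B p st t (rs, M) \<and> t \<le> u \<and> P rs \<and> Q rs"
  by blast

text \<open>The factor 2 comes from \<open>Load\<close> and \<open>Store\<close>, the only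
  instructions that grow. As overflow has no derivation instead of wrapping around, a run under
  \<open>B\<close> remains one under any larger bound; shifted addresses stay below the total length
  and hence fit into a word.\<close>

lemma exec_reloc:
  assumes "exec B p st t st'" "regs p \<subseteq> {..<b}" "\<forall>x<b. rs x = fst st x"
    "rs b = length pre" "length (pre @ snd st @ post) \<le> B'" "B \<le> B'"
  shows "\<exists>t' rs'. exec B' (reloc b p) (rs, pre @ snd st @ post) t' (rs', pre @ snd st' @ post) \<and>
    t' \<le> 2 * t \<and> (\<forall>x<b. rs' x = fst st' x) \<and> (\<forall>x\<ge>b. x \<noteq> Suc b \<longrightarrow> rs' x = rs x)"
  using assms
proof (induction arbitrary: rs rule: exec.induct)
  case (Skip st)
  then show ?case using exec.Skip[of B' "(rs, pre @ snd st @ post)"] by force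
next
  case (Const a x rs0 M)
  then have "exec B' (Const x a) (rs, pre @ M @ post) 1 (rs(x := a), pre @ M @ post)"
    by (intro exec.Const) auto
  then show ?case unfolding reloc.simps fst_conv snd_conv
    by (rule exec_witness) (use Const.prems in auto)
next
  case (Op f rs0 y z x M)
  have "rs y = rs0 y" "rs z = rs0 z" using Op.prems by auto
  then have "exec B' (Op f x y z) (rs, pre @ M @ post) 1
      (rs(x := eval_binop f (rs0 y) (rs0 z)), pre @ M @ post)"
    using exec.Op[of f rs y z B' x "pre @ M @ post"] Op.hyps Op.prems by auto
  then show ?case unfolding reloc.simps fst_conv snd_conv
    by (rule exec_witness) (use Op.prems in auto)
next
  case (Load rs0 y M x)
  let ?rs = "rs(Suc b := rs b + rs y)"
  have y: "rs y = rs0 y" using Load.prems by auto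
  have "exec B' (Op Add (Suc b) b y) (rs, pre @ M @ post) 1 (?rs, pre @ M @ post)"
    using exec.Op[of Add rs b y B' "Suc b" "pre @ M @ post"] Load.hyps Load.prems y by auto
  moreover have "exec B' (Load x (Suc b)) (?rs, pre @ M @ post) 1
      (?rs(x := M ! rs0 y), pre @ M @ post)"
    using exec.Load[of ?rs "Suc b" "pre @ M @ post" B' x] Load.hyps Load.prems y
    by (auto simp: nth_append)
  ultimately have "exec B' (reloc b (Load x y)) (rs, pre @ M @ post) (1 + 1)
      (?rs(x := M ! rs0 y), pre @ M @ post)"
    unfolding reloc.simps by (rule exec.Seq)
  then show ?case unfolding reloc.simps fst_conv snd_conv
    by (rule exec_witness) (use Load.prems in auto)
next
  case (Store rs0 x M y)
  let ?rs = "rs(Suc b := rs b + rs x)"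
  have xy: "rs x = rs0 x" "rs y = rs0 y" "y \<noteq> Suc b" using Store.prems by auto
  have "exec B' (Op Add (Suc b) b x) (rs, pre @ M @ post) 1 (?rs, pre @ M @ post)"
    using exec.Op[of Add rs b x B' "Suc b" "pre @ M @ post"] Store.hyps Store.prems xy by auto
  moreover have "exec B' (Store (Suc b) y) (?rs, pre @ M @ post) 1
      (?rs, pre @ M[rs0 x := rs0 y] @ post)"
    using exec.Store[of ?rs "Suc b" "pre @ M @ post" B' y] Store.hyps Store.prems xy
    by (auto simp: list_update_append)
  ultimately have "exec B' (reloc b (Store x y)) (rs, pre @ M @ post) (1 + 1)
      (?rs, pre @ M[rs0 x := rs0 y] @ post)"
    unfolding reloc.simps by (rule exec.Seq)
  then show ?case unfolding reloc.simps fst_conv snd_conv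
    by (rule exec_witness) (use Store.prems in auto)
next
  case (Seq p st t st' p' t' st'')
  from Seq.IH(1)[of rs] Seq.prems obtain u rs1 where 1:
    "exec B' (reloc b p) (rs, pre @ snd st @ post) u (rs1, pre @ snd st' @ post)"
    "u \<le> 2 * t" "\<forall>x<b. rs1 x = fst st' x" "\<forall>x\<ge>b. x \<noteq> Suc b \<longrightarrow> rs1 x = rs x"
    by auto
  from Seq.IH(2)[of rs1] Seq.prems 1 exec_length[OF Seq.hyps(1)] obtain u' rs2 where 2:
    "exec B' (reloc b p') (rs1, pre @ snd st' @ post) u' (rs2, pre @ snd st'' @ post)"
    "u' \<le> 2 * t'" "\<forall>x<b. rs2 x = fst st'' x" "\<forall>x\<ge>b. x \<noteq> Suc b \<longrightarrow> rs2 x = rs1 x"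
    by auto
  from exec.Seq[OF 1(1) 2(1)] 1 2 show ?case
    by (intro exI[of _ "u + u'"] exI[of _ rs2]) auto
next
  case (If_True rs0 x p M t st' p')
  from If_True.IH[of rs] If_True.prems obtain u rs1 where 1:
    "exec B' (reloc b p) (rs, pre @ M @ post) u (rs1, pre @ snd st' @ post)"
    "u \<le> 2 * t" "\<forall>x<b. rs1 x = fst st' x" "\<forall>x\<ge>b. x \<noteq> Suc b \<longrightarrow> rs1 x = rs x"
    by auto
  have "rs x \<noteq> 0" using If_True by auto
  from exec.If_True[OF this 1(1)] 1 show ?case
    by (intro exI[of _ "1 + u"] exI[of _ rs1]) auto
next
  case (If_False rs0 x p' M t st' p)
  from If_False.IH[of rs] If_False.prems obtain u rs1 where 1:
    "exec B' (reloc b p') (rs, pre @ M @ post) u (rs1, pre @ snd st' @ post)"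
    "u \<le> 2 * t" "\<forall>x<b. rs1 x = fst st' x" "\<forall>x\<ge>b. x \<noteq> Suc b \<longrightarrow> rs1 x = rs x"
    by auto
  have "rs x = 0" using If_False by auto
  from exec.If_False[OF this 1(1)] 1 show ?case
    by (intro exI[of _ "1 + u"] exI[of _ rs1]) auto
next
  case (While_True rs0 x p M t st' t' st'')
  from While_True.IH(1)[of rs] While_True.prems obtain u rs1 where 1:
    "exec B' (reloc b p) (rs, pre @ M @ post) u (rs1, pre @ snd st' @ post)"
    "u \<le> 2 * t" "\<forall>x<b. rs1 x = fst st' x" "\<forall>x\<ge>b. x \<noteq> Suc b \<longrightarrow> rs1 x = rs x"
    by auto
  from While_True.IH(2)[of rs1] While_True.prems 1 exec_length[OF While_True.hyps(2)]
  obtain u' rs2 where 2: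
    "exec B' (While x (reloc b p)) (rs1, pre @ snd st' @ post) u' (rs2, pre @ snd st'' @ post)"
    "u' \<le> 2 * t'" "\<forall>x<b. rs2 x = fst st'' x" "\<forall>x\<ge>b. x \<noteq> Suc b \<longrightarrow> rs2 x = rs1 x"
    by auto
  have "rs x \<noteq> 0" using While_True by auto
  from exec.While_True[OF this 1(1) 2(1)] 1 2 show ?case
    by (intro exI[of _ "1 + u + u'"] exI[of _ rs2]) auto
next
  case (While_False rs0 x p M)
  have "rs x = 0" using While_False by auto
  from exec.While_False[of rs x, OF this] While_False.prems show ?case
    by (intro exI[of _ 1] exI[of _ rs]) auto
qed

section \<open>Running several data structures side by side\<close>

text \<open>A query program expects 0 in all registers but the first two, whereas the preceding run
  leaves its local variables behind.\<close>

primrec clear :: "reg \<Rightarrow> prog" where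
  "clear 0 = Skip"
| "clear (Suc b) = Seq (clear b) (Const b 0)"

lemma exec_clear:
  assumes "0 < B"
  shows "exec B (clear b) (rs, M) (1 + b) (\<lambda>x. if x < b then 0 else rs x, M)"
proof (induction b)
  case 0
  show ?case using exec.Skip[of B "(rs, M)"] by simp
next
  case (Suc b)
  have "(\<lambda>x. if x < b then 0 else rs x)(b := 0) = (\<lambda>x. if x < Suc b then 0 else rs x)"
    by (auto simp: fun_eq_iff)
  with exec.Seq[OF Suc exec.Const[OF assms, of b]] show ?case by simp
qed

text \<open>Reads the table entry at column \<open>a\<close> of the row whose number is in register \<open>y\<close>; \<open>w\<close> is the
  width of a row.\<close>

definition fetch :: "reg \<Rightarrow> nat \<Rightarrow> reg \<Rightarrow> reg \<Rightarrow> nat \<Rightarrow> prog" where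
  "fetch b w x y a = Seq (Const (b + 1) w) (Seq (Op Mul (b + 1) y (b + 1))
     (Seq (Const (b + 6) a) (Seq (Op Add (b + 1) (b + 1) (b + 6)) (Load x (b + 1)))))"

lemma exec_fetch:
  assumes "rs y * w + a < length M" "length M \<le> B" "w < B" "y \<noteq> b + 1"
  shows "\<exists>rs'. exec B (fetch b w x y a) (rs, M) 5 (rs', M) \<and> rs' x = M ! (rs y * w + a) \<and>
    (\<forall>z. z \<notin> {x, b + 1, b + 6} \<longrightarrow> rs' z = rs z)"
proof -
  let ?r1 = "rs(b + 1 := w)" let ?r2 = "?r1(b + 1 := rs y * w)"
  let ?r3 = "?r2(b + 6 := a)" let ?r4 = "?r3(b + 1 := rs y * w + a)"
  let ?r5 = "?r4(x := M ! (rs y * w + a))"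
  have 1: "exec B (Const (b + 1) w) (rs, M) 1 (?r1, M)" using assms by (intro exec.Const)
  have 2: "exec B (Op Mul (b + 1) y (b + 1)) (?r1, M) 1 (?r2, M)"
    using exec.Op[of Mul ?r1 y "b + 1" B "b + 1" M] assms by simp
  have 3: "exec B (Const (b + 6) a) (?r2, M) 1 (?r3, M)"
    using assms by (intro exec.Const) auto
  have 4: "exec B (Op Add (b + 1) (b + 1) (b + 6)) (?r3, M) 1 (?r4, M)"
    using exec.Op[of Add ?r3 "b + 1" "b + 6" B "b + 1" M] assms by simp
  have 5: "exec B (Load x (b + 1)) (?r4, M) 1 (?r5, M)"
    using exec.Load[of ?r4 "b + 1" M B x] assms by simp
  have "exec B (fetch b w x y a) (rs, M) (1 + (1 + (1 + (1 + 1)))) (?r5, M)"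
    unfolding fetch_def by (intro exec.Seq[OF 1] exec.Seq[OF 2] exec.Seq[OF 3] exec.Seq[OF 4] 5)
  then have "exec B (fetch b w x y a) (rs, M) 5 (?r5, M)" by (simp add: numeral_eq_Suc del: fun_upd_apply)
  moreover have "?r5 x = M ! (rs y * w + a)" "\<forall>z. z \<notin> {x, b + 1, b + 6} \<longrightarrow> ?r5 z = rs z"
    by auto
  ultimately show ?thesis by blast
qed

text \<open>Registers \<open>b + 2\<close> and \<open>b + 3\<close> hold the query, \<open>b + 4\<close> the conjunction of the results so far.\<close>

definition subquery :: "reg \<Rightarrow> nat \<Rightarrow> prog \<Rightarrow> nat \<Rightarrow> prog" where
  "subquery b w p r = Seq (clear b) (Seq (fetch b w 0 (b + 2) (3 * r))
     (Seq (fetch b w 1 (b + 3) (3 * r + 1)) (Seq (fetch b w b (b + 2) (3 * r + 2))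
     (Seq (fetch b w (b + 5) (b + 2) (3 * r)) (Seq (reloc b p)
     (Seq (Op Equal (b + 1) 0 (b + 5)) (Op Mul (b + 4) (b + 4) (b + 1))))))))"

text \<open>Register \<open>b + 5\<close> keeps the queried node \<open>v1\<close>, as
  \<open>p\<close> overwrites register 0 with its answer. The overhead \<open>b + 23\<close> is
  \<open>1 + b\<close> for clearing, 5 for each of four fetches and 2 for updating the
  conjunction.\<close>

lemma exec_subquery:
  assumes "regs p \<subseteq> {..<b}" "2 \<le> b" "B \<le> B'" "w < B'" "1 < B'" "rs (b + 4) \<le> 1"
    and Mem: "Mem = pre @ M @ post" "length Mem \<le> B'"
    and bnd: "rs (b + 2) * w + 3 * r + 2 < length Mem" "rs (b + 3) * w + 3 * r + 2 < length Mem"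
    and v: "Mem ! (rs (b + 2) * w + 3 * r) = v1" "Mem ! (rs (b + 3) * w + 3 * r + 1) = v2"
      "Mem ! (rs (b + 2) * w + 3 * r + 2) = length pre"
    and p: "exec B p ((\<lambda>_. 0)(0 := v1, 1 := v2), M) t (rs1, M1)"
  shows "\<exists>t' rs'. exec B' (subquery b w p r) (rs, Mem) t' (rs', pre @ M1 @ post) \<and>
    t' \<le> b + 23 + 2 * t \<and> rs' (b + 2) = rs (b + 2) \<and> rs' (b + 3) = rs (b + 3) \<and>
    rs' (b + 4) = rs (b + 4) * of_bool (rs1 0 = v1)"
proof -
  define ra where "ra = (\<lambda>x. if x < b then 0 else rs x)"
  have a: "exec B' (clear b) (rs, Mem) (1 + b) (ra, Mem)"
    unfolding ra_def using assms by (intro exec_clear) auto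
  obtain rb where b: "exec B' (fetch b w 0 (b + 2) (3 * r)) (ra, Mem) 5 (rb, Mem)"
    "rb 0 = v1" "\<forall>z. z \<notin> {0, b + 1, b + 6} \<longrightarrow> rb z = ra z"
    using exec_fetch[of ra "b + 2" w "3 * r" Mem B' b 0] assms by (auto simp: ra_def)
  obtain rc where c: "exec B' (fetch b w 1 (b + 3) (3 * r + 1)) (rb, Mem) 5 (rc, Mem)"
    "rc 1 = v2" "\<forall>z. z \<notin> {1, b + 1, b + 6} \<longrightarrow> rc z = rb z"
    using exec_fetch[of rb "b + 3" w "3 * r + 1" Mem B' b 1] assms b
    by (auto simp: ra_def add.assoc)
  obtain rd where d: "exec B' (fetch b w b (b + 2) (3 * r + 2)) (rc, Mem) 5 (rd, Mem)"
    "rd b = length pre" "\<forall>z. z \<notin> {b, b + 1, b + 6} \<longrightarrow> rd z = rc z"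
    using exec_fetch[of rc "b + 2" w "3 * r + 2" Mem B' b b] assms b c
    by (auto simp: ra_def add.assoc)
  obtain re where e: "exec B' (fetch b w (b + 5) (b + 2) (3 * r)) (rd, Mem) 5 (re, Mem)"
    "re (b + 5) = v1" "\<forall>z. z \<notin> {b + 5, b + 1, b + 6} \<longrightarrow> re z = rd z"
    using exec_fetch[of rd "b + 2" w "3 * r" Mem B' b "b + 5"] assms b c d
    by (auto simp: ra_def)
  have "re x = ((\<lambda>_. 0)(0 := v1, 1 := v2)) x" if "x < b" for x
    using that assms(2) b c d e by (auto simp: ra_def)
  then obtain t1 rf where f:
    "exec B' (reloc b p) (re, Mem) t1 (rf, pre @ M1 @ post)" "t1 \<le> 2 * t"
    "\<forall>x<b. rf x = rs1 x" "\<forall>x\<ge>b. x \<noteq> Suc b \<longrightarrow> rf x = re x"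
    using exec_reloc[OF p assms(1), of re pre post B'] assms d e by auto
  define rg where "rg = rf(b + 1 := of_bool (rf 0 = rf (b + 5)))"
  have g: "exec B' (Op Equal (b + 1) 0 (b + 5)) (rf, pre @ M1 @ post) 1 (rg, pre @ M1 @ post)"
    unfolding rg_def using exec.Op[of Equal rf 0 "b + 5" B' "b + 1"] assms by simp
  have acc: "rg (b + 4) = rs (b + 4)" "rg (b + 1) = of_bool (rs1 0 = v1)"
    using b c d e f assms(2) by (auto simp: rg_def ra_def)
  define rh where "rh = rg(b + 4 := rg (b + 4) * rg (b + 1))"
  have h: "exec B' (Op Mul (b + 4) (b + 4) (b + 1)) (rg, pre @ M1 @ post) 1 (rh, pre @ M1 @ post)"
    unfolding rh_def using exec.Op[of Mul rg "b + 4" "b + 1" B' "b + 4"] assms acc by simp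
  have "exec B' (subquery b w p r) (rs, Mem)
      (1 + b + (5 + (5 + (5 + (5 + (t1 + (1 + 1))))))) (rh, pre @ M1 @ post)"
    unfolding subquery_def
    by (intro exec.Seq[OF a] exec.Seq[OF b(1)] exec.Seq[OF c(1)] exec.Seq[OF d(1)]
        exec.Seq[OF e(1)] exec.Seq[OF f(1)] exec.Seq[OF g] h)
  moreover have "rh (b + 2) = rs (b + 2)" "rh (b + 3) = rs (b + 3)"
    "rh (b + 4) = rs (b + 4) * of_bool (rs1 0 = v1)"
    using acc b c d e f assms(2) by (auto simp: rg_def rh_def ra_def)
  ultimately show ?thesis using f(2) by (intro exI[of _ rh] exI) auto
qed

primrec subqueries :: "reg \<Rightarrow> nat \<Rightarrow> prog \<Rightarrow> nat \<Rightarrow> prog" where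
  "subqueries b w p 0 = Skip"
| "subqueries b w p (Suc r) = Seq (subqueries b w p r) (subquery b w p r)"

text \<open>The invariant fixes the table \<open>H\<close> and the lengths \<open>Ls\<close>, but
  lets each memory move within its \<open>R r\<close>. This is enough for the stored offsets to stay
  correct.\<close>

lemma exec_subqueries:
  fixes T :: real
  assumes "regs p \<subseteq> {..<b}" "2 \<le> b" "B \<le> B'" "w < B'" "1 < B'"
    and rs: "rs (b + 2) = i" "rs (b + 3) = j" "rs (b + 4) = 1"
    and Ms: "map length Ms = Ls" "\<forall>r<k. Ms ! r \<in> R r" "length Ls = k"
    and bnd: "i * w + w \<le> length H" "j * w + w \<le> length H" "3 * k \<le> w"
      "length H + sum_list Ls \<le> B'"
    and H: "\<forall>r<k. H ! (i * w + 3 * r) = v1 r" "\<forall>r<k. H ! (j * w + 3 * r + 1) = v2 r"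
      "\<forall>r<k. H ! (i * w + 3 * r + 2) = length H + sum_list (take r Ls)"
    and p: "\<And>r M. r < k \<Longrightarrow> M \<in> R r \<Longrightarrow>
      \<exists>t rs1 M1. exec B p ((\<lambda>_. 0)(0 := v1 r, 1 := v2 r), M) t (rs1, M1) \<and> real t \<le> T \<and>
        M1 \<in> R r \<and> (rs1 0 = v1 r \<longleftrightarrow> P r)"
    and "n \<le> k"
  shows "\<exists>t rs' Ms'. exec B' (subqueries b w p n) (rs, H @ concat Ms) t (rs', H @ concat Ms') \<and>
    map length Ms' = Ls \<and> (\<forall>r<k. Ms' ! r \<in> R r) \<and> rs' (b + 2) = i \<and> rs' (b + 3) = j \<and>
    rs' (b + 4) = of_bool (\<forall>r<n. P r) \<and> real t \<le> 1 + real n * (real b + 23 + 2 * T)"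
  using \<open>n \<le> k\<close>
proof (induction n)
  case 0
  show ?case unfolding subqueries.simps
    by (rule exI, rule exI, rule exI, rule conjI[OF exec.Skip]) (use rs Ms in auto)
next
  case (Suc n)
  then obtain t rs' Ms' where IH:
    "exec B' (subqueries b w p n) (rs, H @ concat Ms) t (rs', H @ concat Ms')"
    "map length Ms' = Ls" "\<forall>r<k. Ms' ! r \<in> R r" "rs' (b + 2) = i" "rs' (b + 3) = j"
    "rs' (b + 4) = of_bool (\<forall>r<n. P r)" "real t \<le> 1 + real n * (real b + 23 + 2 * T)"
    by (meson Suc_leD)
  have n: "n < k" "length Ms' = k" using Suc.prems IH(2) Ms(3) by auto
  let ?pre = "H @ concat (take n Ms')" and ?post = "concat (drop (Suc n) Ms')"
  have split: "H @ concat Ms' = ?pre @ Ms' ! n @ ?post"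
    using id_take_nth_drop[of n Ms'] n by (metis append.assoc concat.simps(2) concat_append)
  have pre: "length ?pre = length H + sum_list (take n Ls)"
    by (simp add: length_concat IH(2)[symmetric] take_map)
  obtain u rs1 M1 where p1: "exec B p ((\<lambda>_. 0)(0 := v1 n, 1 := v2 n), Ms' ! n) u (rs1, M1)"
    "real u \<le> T" "M1 \<in> R n" "rs1 0 = v1 n \<longleftrightarrow> P n"
    using p[of n "Ms' ! n"] n IH(3) by auto
  have len: "length (H @ concat Ms') = length H + sum_list Ls"
    by (simp add: length_concat IH(2))
  have o: "3 * n + 2 < w" using n bnd by auto
  have "\<exists>t' rs2. exec B' (subquery b w p n) (rs', H @ concat Ms') t' (rs2, ?pre @ M1 @ ?post) \<and>
    t' \<le> b + 23 + 2 * u \<and> rs2 (b + 2) = rs' (b + 2) \<and> rs2 (b + 3) = rs' (b + 3) \<and>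
    rs2 (b + 4) = rs' (b + 4) * of_bool (rs1 0 = v1 n)"
  proof (rule exec_subquery[OF assms(1-5) _ split _ _ _ _ _ _ p1(1)])
    show "rs' (b + 4) \<le> 1" using IH by simp
    show "length (H @ concat Ms') \<le> B'" using len bnd by simp
    show "rs' (b + 2) * w + 3 * n + 2 < length (H @ concat Ms')"
      "rs' (b + 3) * w + 3 * n + 2 < length (H @ concat Ms')" using IH bnd o by auto
    show "(H @ concat Ms') ! (rs' (b + 2) * w + 3 * n) = v1 n"
      using IH bnd o H(1) n by (auto simp: nth_append)
    show "(H @ concat Ms') ! (rs' (b + 3) * w + 3 * n + 1) = v2 n"
      using IH bnd o H(2) n by (auto simp: nth_append)
    have "(H @ concat Ms') ! (rs' (b + 2) * w + 3 * n + 2) = H ! (i * w + 3 * n + 2)"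
      using IH bnd o by (auto simp: nth_append)
    then show "(H @ concat Ms') ! (rs' (b + 2) * w + 3 * n + 2) = length ?pre"
      using H(3) n pre by auto
  qed
  then obtain t' rs2 where s:
    "exec B' (subquery b w p n) (rs', H @ concat Ms') t' (rs2, ?pre @ M1 @ ?post)"
    "t' \<le> b + 23 + 2 * u" "rs2 (b + 2) = i" "rs2 (b + 3) = j"
    "rs2 (b + 4) = of_bool (\<forall>r<n. P r) * of_bool (P n)"
    using IH p1(4) by auto
  let ?Ms = "Ms'[n := M1]"
  have "H @ concat ?Ms = ?pre @ M1 @ ?post"
    using n by (simp add: upd_conv_take_nth_drop)
  moreover have "map length ?Ms = Ls"
    using exec_length[OF p1(1)] IH(2) n
    by (metis list_update_id map_update nth_map snd_conv)
  moreover have "\<forall>r<k. ?Ms ! r \<in> R r" using IH(3) p1(3) n by (simp add: nth_list_update)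
  moreover have "rs2 (b + 4) = of_bool (\<forall>r<Suc n. P r)" using s(5) by (auto simp: less_Suc_eq)
  moreover have "real (t + t') \<le> 1 + real (Suc n) * (real b + 23 + 2 * T)"
  proof -
    have "real t' \<le> real b + 23 + 2 * T"
      using s(2) p1(2) by linarith
    then show ?thesis using IH(7) by (simp add: algebra_simps)
  qed
  ultimately show ?case unfolding subqueries.simps
    using exec.Seq[OF IH(1) s(1)] s(3,4)
    by (intro exI[of _ "t + t'"] exI[of _ rs2] exI[of _ ?Ms] conjI) simp_all
qed

text \<open>There is no move instruction: the query is copied by adding a register that is still 0,
  and the result by multiplying with 1.\<close>

definition all_subqueries :: "reg \<Rightarrow> nat \<Rightarrow> prog \<Rightarrow> prog" where
  "all_subqueries b k p = Seq (Op Add (b + 2) 0 (b + 3)) (Seq (Op Add (b + 3) 1 (b + 4))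
     (Seq (Const (b + 4) 1) (Seq (subqueries b (3 * k) p k)
     (Seq (Const 0 1) (Op Mul 0 0 (b + 4))))))"

text \<open>The memory is a table of \<open>N\<close> rows with \<open>3 * k\<close> entries (first
  node, second node and offset for each \<open>r\<close>), followed by the \<open>k\<close>
  memories. The 6 extra steps are the five instructions around the subqueries and the initial
  \<open>Skip\<close>. Only \<open>k\<close>, not \<open>N\<close>, enters the program.\<close>

lemma answers_queries_conjunction:
  fixes S T :: real
  assumes p: "regs p \<subseteq> {..<b}" "2 \<le> b"
    and sub: "\<And>r. r < k \<Longrightarrow> answers_queries B p (R r) Q (ans r) S T"
    and Q: "\<And>r i j. r < k \<Longrightarrow> i < N \<Longrightarrow> j < N \<Longrightarrow> (f r i, g r j) \<in> Q"
    and ans: "\<And>r i j x y. r < k \<Longrightarrow> i < N \<Longrightarrow> j < N \<Longrightarrow> ans r (f r i) (g r j) x y \<Longrightarrow>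
      x = f r i \<longleftrightarrow> P r i j"
    and fg: "\<And>r i. r < k \<Longrightarrow> i < N \<Longrightarrow> f r i < B' \<and> g r i < B'"
    and B': "N * (3 * k) + k * B + 3 * k + N + 1 < B'" "B \<le> B'"
  shows "\<exists>R'. answers_queries B' (all_subqueries b k p) R' ({..<N} \<times> {..<N})
    (\<lambda>i j x _. x = of_bool (\<forall>r<k. P r i j))
    (real (N * (3 * k)) + real k * S) (6 + real k * (real b + 23 + 2 * T))"
proof -
  define w where "w = 3 * k"
  have R: "real (length M) \<le> S" "length M \<le> B" "\<forall>x\<in>set M. x < B" if "r < k" "M \<in> R r" for r M
    using sub[OF that(1)] that(2) unfolding answers_queries_def by blast+
  have "\<forall>r<k. \<exists>M. M \<in> R r"
    using sub unfolding answers_queries_def by (meson ex_in_conv)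
  then obtain M0 where M0: "\<And>r. r < k \<Longrightarrow> M0 r \<in> R r" by metis
  \<comment> \<open>The offset of the \<open>r\<close>-th memory is repeated in every row of the table \<open>H\<close>, so that the program
    finds it by constants that do not depend on \<open>N\<close>.\<close>
  define Ls where "Ls = map (length \<circ> M0) [0..<k]"
  define H where "H = map (\<lambda>a. let i = a div w; o' = a mod w; r = o' div 3 in
     if o' mod 3 = 0 then f r i else if o' mod 3 = 1 then g r i
     else N * w + sum_list (take r Ls)) [0..<N * w]"
  \<comment> \<open>\<open>R r\<close> may contain memories of several lengths; they are frozen to
    those of \<open>M0 r\<close>, so that one table fits all of \<open>R'\<close>.\<close>
  define R' where "R' = {H @ concat Ms | Ms. map length Ms = Ls \<and> (\<forall>r<k. Ms ! r \<in> R r)}"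
  have lenH: "length H = N * w" by (simp add: H_def)
  have lenLs: "length Ls = k" by (simp add: Ls_def)
  have row: "i * w + a < N * w" if "i < N" "a < w" for i a
  proof -
    have "i * w + a < Suc i * w" using that by simp
    also have "\<dots> \<le> N * w" using that by (intro mult_right_mono) auto
    finally show ?thesis .
  qed
  have H: "H ! (i * w + 3 * r) = f r i" "H ! (i * w + 3 * r + 1) = g r i"
    "H ! (i * w + 3 * r + 2) = length H + sum_list (take r Ls)" if "i < N" "r < k" for i r
  proof -
    have nth: "H ! (i * w + a) = (if a mod 3 = 0 then f (a div 3) i
      else if a mod 3 = 1 then g (a div 3) i else N * w + sum_list (take (a div 3) Ls))"
      if "a < w" for a
      using row[OF \<open>i < N\<close> that] that by (simp add: H_def Let_def)
    have r: "3 * r < w" "3 * r + 1 < w" "3 * r + 2 < w" using that by (auto simp: w_def)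
    have "(3 * r + 1) mod 3 = 1" "(3 * r + 1) div 3 = r" "(3 * r + 2) mod 3 = 2"
      "(3 * r + 2) div 3 = r" by presburger+
    then show "H ! (i * w + 3 * r) = f r i" "H ! (i * w + 3 * r + 1) = g r i"
      "H ! (i * w + 3 * r + 2) = length H + sum_list (take r Ls)"
      using nth[OF r(1)] nth[OF r(2)] nth[OF r(3)] lenH by (simp_all only: add.assoc) simp_all
  qed
  have sumLs: "sum_list Ls \<le> k * B"
  proof -
    have "sum_list Ls \<le> sum_list (map (\<lambda>_. B) [0..<k])" unfolding Ls_def
      using R M0 by (intro sum_list_mono) auto
    then show ?thesis by (simp add: sum_list_triv)
  qed
  have sumLs_S: "real (sum_list Ls) \<le> real k * S"
  proof -
    have "real (sum_list Ls) = (\<Sum>r\<leftarrow>[0..<k]. real (length (M0 r)))"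
      unfolding Ls_def by (induction k) auto
    also have "\<dots> \<le> (\<Sum>r\<leftarrow>[0..<k]. S)"
      using R M0 by (intro sum_list_mono) auto
    finally show ?thesis by (simp add: sum_list_triv)
  qed
  have lenR': "length M = N * w + sum_list Ls" if "M \<in> R'" for M
    using that lenH by (auto simp: R'_def length_concat)
  have Ls_take: "sum_list (take r Ls) \<le> sum_list Ls" for r
    by (metis append_take_drop_id le_add1 sum_list_append)
  show ?thesis unfolding answers_queries_def
  proof (intro exI[of _ R'] conjI ballI)
    have "H @ concat (map M0 [0..<k]) \<in> R'" using M0 by (auto simp: R'_def Ls_def)
    then show "R' \<noteq> {}" by auto
  next
    fix M assume M: "M \<in> R'"
    then obtain Ms where Ms: "M = H @ concat Ms" "map length Ms = Ls" "\<forall>r<k. Ms ! r \<in> R r"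
      by (auto simp: R'_def)
    show "real (length M) \<le> real (N * (3 * k)) + real k * S"
      using lenR'[OF M] sumLs_S by (simp add: w_def)
    show "length M \<le> B'" using lenR'[OF M] sumLs B' by (simp add: w_def)
    fix x assume "x \<in> set M"
    then consider "x \<in> set H" | L where "L \<in> set Ms" "x \<in> set L" using Ms by auto
    then show "x < B'"
    proof cases
      case 1
      then obtain a where a: "a < N * w" "x = H ! a" using lenH by (auto simp: in_set_conv_nth)
      define i c r where "i = a div w" "c = a mod w" "r = c div 3"
      have w: "0 < w" using a by (cases "w = 0") auto
      have "a = i * w + c" by (simp add: i_c_r_def)
      moreover have "i < N" using a by (simp add: i_c_r_def less_mult_imp_div_less)
      moreover have "r < k"
      proof -
        have "c < w" using w by (simp add: i_c_r_def)
        moreover have "3 * r \<le> c" by (simp add: i_c_r_def)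
        ultimately show ?thesis by (simp add: w_def)
      qed
      moreover have "c = 3 * r \<or> c = 3 * r + 1 \<or> c = 3 * r + 2"
        unfolding i_c_r_def(3) by presburger
      ultimately have "x = f r i \<or> x = g r i \<or> x = length H + sum_list (take r Ls)"
        using H[of i r] a(2) by (auto simp: add.assoc)
      moreover have "length H + sum_list (take r Ls) < B'"
        using lenH Ls_take[of r] sumLs B' by (simp add: w_def)
      ultimately show ?thesis using fg[OF \<open>r < k\<close> \<open>i < N\<close>] B' by auto
    next
      case 2
      then obtain r where "r < length Ms" "L = Ms ! r" by (auto simp: in_set_conv_nth)
      moreover have "length Ms = k" using Ms lenLs by auto
      ultimately have "L \<in> R r" "r < k" using Ms by auto
      with R 2 have "x < B" by blast
      with B' show ?thesis by simp
    qed
  next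
    fix M ij assume M: "M \<in> R'" and "ij \<in> {..<N} \<times> {..<N}"
    then obtain i j where ij: "ij = (i, j)" "i < N" "j < N" by auto
    from M obtain Ms where Ms: "M = H @ concat Ms" "map length Ms = Ls" "\<forall>r<k. Ms ! r \<in> R r"
      by (auto simp: R'_def)
    let ?rs0 = "(\<lambda>_. 0)(0 := i, 1 := j)"
    let ?rs1 = "?rs0(b + 2 := i)" let ?rs2 = "?rs1(b + 3 := j)" let ?rs3 = "?rs2(b + 4 := 1)"
    have 1: "exec B' (Op Add (b + 2) 0 (b + 3)) (?rs0, M) 1 (?rs1, M)"
      using exec.Op[of Add ?rs0 0 "b + 3" B' "b + 2" M] ij B' by auto
    have 2: "exec B' (Op Add (b + 3) 1 (b + 4)) (?rs1, M) 1 (?rs2, M)"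
      using exec.Op[of Add ?rs1 1 "b + 4" B' "b + 3" M] ij B' p(2) by auto
    have 3: "exec B' (Const (b + 4) 1) (?rs2, M) 1 (?rs3, M)"
      using B' by (intro exec.Const) auto
    have "\<exists>t rs' Ms'. exec B' (subqueries b w p k) (?rs3, H @ concat Ms) t (rs', H @ concat Ms') \<and>
      map length Ms' = Ls \<and> (\<forall>r<k. Ms' ! r \<in> R r) \<and> rs' (b + 2) = i \<and> rs' (b + 3) = j \<and>
      rs' (b + 4) = of_bool (\<forall>r<k. P r i j) \<and> real t \<le> 1 + real k * (real b + 23 + 2 * T)"
    proof (rule exec_subqueries[where B = B and ?v1.0 = "\<lambda>r. f r i" and ?v2.0 = "\<lambda>r. g r j"])
      show "i * w + w \<le> length H" "j * w + w \<le> length H"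
        using mult_right_mono[of "Suc i" N w] mult_right_mono[of "Suc j" N w] ij lenH by auto
      show "length H + sum_list Ls \<le> B'" using lenH sumLs B' by (simp add: w_def)
      show "\<exists>t rs1 M1. exec B p ((\<lambda>_. 0)(0 := f r i, 1 := g r j), L) t (rs1, M1) \<and> real t \<le> T \<and>
        M1 \<in> R r \<and> (rs1 0 = f r i \<longleftrightarrow> P r i j)" if "r < k" "L \<in> R r" for r L
      proof -
        have "(f r i, g r j) \<in> Q" using Q that ij by auto
        with sub[OF that(1)] that(2) ans[OF that(1) ij(2,3)] show ?thesis
          unfolding answers_queries_def by fast
      qed
    qed (use p B' ij H Ms lenLs in \<open>auto simp: w_def\<close>)
    then obtain t rs' Ms' where 4:
      "exec B' (subqueries b (3 * k) p k) (?rs3, M) t (rs', H @ concat Ms')"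
      "map length Ms' = Ls" "\<forall>r<k. Ms' ! r \<in> R r"
      "rs' (b + 4) = of_bool (\<forall>r<k. P r i j)"
      "real t \<le> 1 + real k * (real b + 23 + 2 * T)"
      unfolding w_def Ms(1) by blast
    let ?M = "H @ concat Ms'"
    have 5: "exec B' (Const 0 1) (rs', ?M) 1 (rs'(0 := 1), ?M)"
      using B' by (intro exec.Const) auto
    have 6: "exec B' (Op Mul 0 0 (b + 4)) (rs'(0 := 1), ?M) 1 (rs'(0 := rs' (b + 4)), ?M)"
      using exec.Op[of Mul "rs'(0 := 1)" 0 "b + 4" B' 0 ?M] B' 4(4) by simp
    have "exec B' (all_subqueries b k p) (?rs0, M) (1 + (1 + (1 + (t + (1 + 1)))))
        (rs'(0 := rs' (b + 4)), ?M)"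
      unfolding all_subqueries_def
      by (intro exec.Seq[OF 1] exec.Seq[OF 2] exec.Seq[OF 3] exec.Seq[OF 4(1)] exec.Seq[OF 5] 6)
    moreover have "?M \<in> R'" using 4 by (auto simp: R'_def)
    ultimately show "case ij of (i, j) \<Rightarrow> \<exists>t rs M'.
        exec B' (all_subqueries b k p) ((\<lambda>_. 0)(0 := i, 1 := j), M) t (rs, M') \<and>
        real t \<le> 6 + real k * (real b + 23 + 2 * T) \<and> M' \<in> R' \<and>
        rs 0 = of_bool (\<forall>r<k. P r i j)"
      unfolding ij(1) prod.case using 4(4,5)
      by (intro exI[of _ "1 + (1 + (1 + (t + (1 + 1))))"] exI[of _ "rs'(0 := rs' (b + 4))"]
          exI[of _ ?M]) auto
  qed
qed

section \<open>Elementary properties of data structures\<close>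

lemma answers_queriesD:
  assumes "answers_queries B p R Q ans S T" "M \<in> R" "(a, b) \<in> Q"
  shows "\<exists>t rs M'. exec B p ((\<lambda>_. 0)(0 := a, 1 := b), M) t (rs, M') \<and> real t \<le> T \<and>
    M' \<in> R \<and> ans a b (rs 0) (rs 1)"
  using assms unfolding answers_queries_def by fast

lemma answers_queries_weaken:
  assumes "answers_queries B p R Q ans S T" "S \<le> S'" "T \<le> T'"
    and "\<And>a b x y. (a, b) \<in> Q \<Longrightarrow> ans a b x y \<Longrightarrow> ans' a b x y"
  shows "answers_queries B p R Q ans' S' T'"
  unfolding answers_queries_def
proof (intro conjI ballI)
  show "R \<noteq> {}" using assms(1) unfolding answers_queries_def by blast
next
  fix M assume M: "M \<in> R"
  then have *: "real (length M) \<le> S \<and> length M \<le> B \<and> (\<forall>x\<in>set M. x < B)"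
    using assms(1) unfolding answers_queries_def by blast
  then show "real (length M) \<le> S'" "length M \<le> B" using assms(2) by auto
  show "x < B" if "x \<in> set M" for x using * that by blast
  fix ab assume "ab \<in> Q"
  then obtain a b where ab: "ab = (a, b)" "(a, b) \<in> Q" by (cases ab) auto
  then obtain t rs M' where "exec B p ((\<lambda>_. 0)(0 := a, 1 := b), M) t (rs, M')" "real t \<le> T"
    "M' \<in> R" "ans a b (rs 0) (rs 1)"
    using assms(1) M unfolding answers_queries_def by fast
  with assms(3) assms(4)[OF ab(2)] show "case ab of (a, b) \<Rightarrow> \<exists>t rs M'.
      exec B p ((\<lambda>_. 0)(0 := a, 1 := b), M) t (rs, M') \<and> real t \<le> T' \<and> M' \<in> R \<and>
      ans' a b (rs 0) (rs 1)"
    unfolding ab(1) prod.case by (meson order_trans)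
qed

text \<open>Every run takes a step; this lets \<open>q\<close> absorb the additive constants of the
  reduction.\<close>

lemma answers_queries_time_ge_1:
  assumes "answers_queries B p R Q ans S T" "(a, b) \<in> Q"
  shows "1 \<le> T"
proof -
  obtain M where "M \<in> R" using assms(1) unfolding answers_queries_def by blast
  then obtain t st where "exec B p ((\<lambda>_. 0)(0 := a, 1 := b), M) t st" "real t \<le> T"
    using assms unfolding answers_queries_def by fast
  with exec_time_pos[OF this(1)] show ?thesis by linarith
qed

lemma answers_queries_space_nonneg:
  "answers_queries B p R Q ans S T \<Longrightarrow> 0 \<le> S"
  unfolding answers_queries_def by (meson ex_in_conv of_nat_0_le_iff order_trans)

section \<open>Trees of height two\<close>

lemma downpath_childless:
  assumes "downpath T v xs w" "\<And>u. \<not> is_child T v u"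
  shows "xs = [] \<and> w = v"
  using assms by cases auto

lemma downpath_height_1:
  assumes "downpath T v xs w" and h: "\<And>a b. is_child T v a \<Longrightarrow> \<not> is_child T a b"
  shows "xs = [] \<and> w = v \<or> xs = [edge_label T w] \<and> is_child T v w"
  using assms(1)
proof cases
  case (Cons u ys)
  with downpath_childless[OF Cons(3)] h show ?thesis by auto
qed simp

text \<open>Common strings have length at most 1 here. Two equally labelled edges realise length 1,
  and maximality then forces it; without such edges only the empty string is common. Only
  \<open>u1\<close> is described, since the program inspects nothing else.\<close>

lemma is_LCE_TT_height_1:
  assumes T: "is_LCE_TT T v1 v2 xs u1 u2"
    and h1: "\<And>a b. is_child T v1 a \<Longrightarrow> \<not> is_child T a b"
    and h2: "\<And>a b. is_child T v2 a \<Longrightarrow> \<not> is_child T a b"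
  shows "if \<exists>a b. is_child T v1 a \<and> is_child T v2 b \<and> edge_label T a = edge_label T b
    then is_child T v1 u1 else u1 = v1"
proof -
  from T have d: "downpath T v1 xs u1" "downpath T v2 xs u2"
    by (auto simp: is_LCE_TT_def is_LCE_PP_def equal_prefixes_def)
  note d = downpath_height_1[OF d(1) h1] downpath_height_1[OF d(2) h2]
  show ?thesis
  proof (cases "\<exists>a b. is_child T v1 a \<and> is_child T v2 b \<and> edge_label T a = edge_label T b")
    case True
    then obtain a b where ab: "is_child T v1 a" "is_child T v2 b" "edge_label T a = edge_label T b"
      by auto
    have lt: "a < nnodes T" "b < nnodes T" using ab by (auto simp: is_child_def)
    have down: "downpath T v1 [edge_label T a] a" "downpath T v2 [edge_label T a] b"
      "descendant T a a" "descendant T b b"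
      using downpath.Cons[OF ab(1) downpath.Nil] downpath.Cons[OF ab(2) downpath.Nil] lt ab(3)
      by (auto simp: descendant_def intro: downpath.Nil)
    have "descendant_leaf T v1 a" "descendant_leaf T v2 b"
      using down h1[OF ab(1)] h2[OF ab(2)] by (auto simp: descendant_leaf_def descendant_def)
    \<comment> \<open>Makes this pair a competitor in the maximality clause of
      \<open>is_LCE_TT\<close>.\<close>
    moreover have "is_LCE_PP T v1 a v2 b [edge_label T a] a b"
      unfolding is_LCE_PP_def
    proof (intro conjI allI impI)
      show "equal_prefixes T v1 a v2 b [edge_label T a] a b"
        using down by (simp add: equal_prefixes_def)
      fix ys x1 x2 assume "equal_prefixes T v1 a v2 b ys x1 x2"
      then have "downpath T v1 ys x1" by (simp add: equal_prefixes_def)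
      from downpath_height_1[OF this h1] show "length ys \<le> length [edge_label T a]" by auto
    qed
    ultimately have "length [edge_label T a] \<le> length xs"
      using T unfolding is_LCE_TT_def by blast
    with True d(1) show ?thesis by auto
  next
    case False
    then show ?thesis using d by auto
  qed
qed

definition two_level :: "nat \<Rightarrow> nat set \<Rightarrow> (nat \<Rightarrow> nat) \<Rightarrow> (nat \<Rightarrow> 'a) \<Rightarrow> 'a ltree" where
  "two_level n L \<phi> lab = \<lparr>nnodes = n, rootnode = 0,
     parent = (\<lambda>v. if v \<in> L then \<phi> v else 0), edge_label = lab\<rparr>"

lemma two_level_simps [simp]:
  "nnodes (two_level n L \<phi> lab) = n" "rootnode (two_level n L \<phi> lab) = 0"
  "edge_label (two_level n L \<phi> lab) = lab"
  "is_child (two_level n L \<phi> lab) u v \<longleftrightarrow> 0 < v \<and> v < n \<and> u = (if v \<in> L then \<phi> v else 0)"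
  by (auto simp: two_level_def is_child_def)

lemma is_ltree_two_level:
  assumes "0 < n" "\<And>v. v \<in> L \<Longrightarrow> \<phi> v \<in> {1..<n} - L"
  shows "is_ltree (two_level n L \<phi> lab)"
  unfolding is_ltree_def
proof (intro conjI allI impI)
  let ?T = "two_level n L \<phi> lab"
  show "rootnode ?T < nnodes ?T" using assms by simp
  show "parent ?T v < nnodes ?T" if "v < nnodes ?T" "v \<noteq> rootnode ?T" for v
    using that assms by (auto simp: two_level_def)
  have 1: "(is_child ?T)\<^sup>*\<^sup>* 0 v" if "v < n" "v \<notin> L" for v
    using that by (cases "v = 0") (auto intro: r_into_rtranclp)
  show "(is_child ?T)\<^sup>*\<^sup>* (rootnode ?T) v" if "v < nnodes ?T" for v
  proof (cases "v \<in> L \<and> v \<noteq> 0")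
    case True
    then have "(is_child ?T)\<^sup>*\<^sup>* 0 (\<phi> v)" using assms(2)[of v] by (intro 1) auto
    moreover have "is_child ?T (\<phi> v) v" using True that by auto
    ultimately show ?thesis by (auto intro: rtranclp.rtrancl_into_rtrancl)
  next
    case False
    then show ?thesis using that 1 by (cases "v = 0") auto
  qed
qed

text \<open>A key \<open>k\<close> becomes a child of the root whose children are leaves labelled by the \<open>x\<close> with
  \<open>(k, x) \<in> A\<close>. All keys without incidences share the leaf 1, since there may be more than \<open>n\<close>
  of them.\<close>

lemma ex_incidence_tree:
  fixes A :: "('k \<times> 'a) set"
  assumes A: "finite A" "2 + 2 * card A \<le> n"
  shows "\<exists>(T :: 'a ltree) h. is_ltree T \<and> nnodes T = n \<and> (\<forall>k. h k < n) \<and>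
    (\<forall>k l xs u1 u2. is_LCE_TT T (h k) (h l) xs u1 u2 \<longrightarrow>
      (u1 = h k \<longleftrightarrow> \<not> (\<exists>x. (k, x) \<in> A \<and> (l, x) \<in> A)))"
proof -
  define a where "a = card A"
  define X where "X = fst ` A"
  have X: "finite X" "card X \<le> a" using A card_image_le by (auto simp: X_def a_def)
  obtain e where e: "bij_betw e A {0..<a}"
    using ex_bij_betw_finite_nat[OF A(1)] by (auto simp: a_def)
  obtain idx where idx: "bij_betw idx X {0..<card X}" using ex_bij_betw_finite_nat[OF X(1)] by auto
  have idx_lt: "idx k < a" if "k \<in> X" for k
    using bij_betwE[OF idx] that X(2) by fastforce
  \<comment> \<open>Numbering: 0 is the root, 1 the shared leaf, the next \<open>a\<close> numbers
    are reserved for keys, the following \<open>a\<close> form \<open>L\<close>, one leaf per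
    incidence. Everything from \<open>2 + 2 * a\<close> on is padding.\<close>
  define h where "h k = (if k \<in> X then 2 + idx k else 1)" for k
  define g where "g v = inv_into A e (v - (2 + a))" for v
  define L where "L = {2 + a..<2 + 2 * a}"
  define T where "T = two_level n L (\<lambda>v. h (fst (g v))) (\<lambda>v. snd (g v))"
  have g_in: "g v \<in> A" "v = 2 + a + e (g v)" if "v \<in> L" for v
  proof -
    have "v - (2 + a) \<in> e ` A" using that e by (auto simp: L_def bij_betw_def)
    then show "g v \<in> A" "v = 2 + a + e (g v)"
      using that inv_into_into[of "v - (2 + a)" e A] f_inv_into_f[of "v - (2 + a)" e A]
      by (auto simp: g_def L_def)
  qed
  have g_e: "2 + a + e y \<in> L" "g (2 + a + e y) = y" if "y \<in> A" for y
    using that e bij_betwE[OF e] by (auto simp: g_def L_def bij_betw_def)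
  have h_range: "1 \<le> h k" "h k < 2 + a" for k using idx_lt[of k] by (auto simp: h_def)
  have h_notin: "h k \<notin> L" for k using h_range[of k] by (auto simp: L_def)
  have h_eq: "h k = h l \<longleftrightarrow> k = l" if "k \<in> X" for k l
    using that idx by (auto simp: h_def bij_betw_def inj_on_eq_iff)
  have h_lt: "h k < n" for k using h_range[of k] A by (auto simp: a_def)
  have child: "is_child T (h k) v \<longleftrightarrow> v \<in> L \<and> fst (g v) = k" for k v
  proof -
    have "v \<in> L \<Longrightarrow> 0 < v \<and> v < n" using A by (auto simp: L_def a_def)
    moreover have "v \<in> L \<Longrightarrow> fst (g v) \<in> X" using g_in(1) by (auto simp: X_def)
    moreover have "h k \<noteq> 0" using h_range(1)[of k] by simp
    ultimately show ?thesis unfolding T_def two_level_simps using h_eq[of "fst (g v)" k] by metis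
  qed
  have h1: "\<not> is_child T v w" if "is_child T (h k) v" for k v w
  proof -
    have "v \<in> L" using that child by blast
    then have "v \<noteq> 0" "\<forall>k. v \<noteq> h k" using h_notin by (auto simp: L_def)
    then show ?thesis unfolding T_def two_level_simps by simp
  qed
  have "is_ltree T" unfolding T_def
    using A h_range(1) h_lt h_notin by (intro is_ltree_two_level) auto
  moreover have "u1 = h k \<longleftrightarrow> \<not> (\<exists>x. (k, x) \<in> A \<and> (l, x) \<in> A)"
    if "is_LCE_TT T (h k) (h l) xs u1 u2" for k l xs u1 u2
  proof -
    have "(\<exists>v w. is_child T (h k) v \<and> is_child T (h l) w \<and> edge_label T v = edge_label T w) \<longleftrightarrow>
      (\<exists>x. (k, x) \<in> A \<and> (l, x) \<in> A)" (is "?l \<longleftrightarrow> ?r")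
    proof
      assume ?l
      then obtain v w where vw: "v \<in> L" "fst (g v) = k" "w \<in> L" "fst (g w) = l"
        "snd (g v) = snd (g w)"
        by (auto simp: child) (auto simp: T_def)
      then have "(k, snd (g v)) \<in> A" "(l, snd (g v)) \<in> A"
        using g_in(1)[of v] g_in(1)[of w] by (metis prod.collapse)+
      then show ?r by blast
    next
      assume ?r
      then obtain x where x: "(k, x) \<in> A" "(l, x) \<in> A" by auto
      have "edge_label T v = snd (g v)" for v by (simp add: T_def)
      then show ?l using g_e[OF x(1)] g_e[OF x(2)] unfolding child
        by (intro exI[of _ "2 + a + e (k, x)"] exI[of _ "2 + a + e (l, x)"]) auto
    qed
    \<comment> \<open>Without this, a nonempty LCE ending in a child of \<open>h k\<close> would not
      exclude \<open>u1 = h k\<close>.\<close>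
    moreover have "\<not> is_child T (h k) (h k)" using h1 by blast
    ultimately show ?thesis using is_LCE_TT_height_1[OF that h1[of k] h1[of l]] by (auto split: if_splits)
  qed
  ultimately show ?thesis using h_lt by (intro exI[of _ T] exI[of _ h]) (auto simp: T_def)
qed

section \<open>A lower bound on the space of an LCE data structure\<close>

text \<open>The \<open>b\<close> largest factors of the factorial all exceed \<open>a\<close>. With
  \<open>a = b\<close> this is a crude substitute for Stirling's formula.\<close>

lemma power_le_fact: "a ^ b \<le> (fact (a + b) :: nat)"
proof (induction b)
  case (Suc b)
  have "a * a ^ b \<le> (a + Suc b) * fact (a + b)" using Suc by (intro mult_mono) auto
  then show ?case by simp
qed simp

lemma card_bounded_lists_le:
  assumes "2 \<le> B"
  shows "card {xs :: nat list. set xs \<subseteq> {..<B} \<and> length xs \<le> l} \<le> B ^ Suc l"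
proof -
  have "(\<Sum>i\<le>l. B ^ i) \<le> B ^ Suc l"
  proof (induction l)
    case 0
    then show ?case using assms by simp
  next
    case (Suc l)
    then have "(\<Sum>i\<le>Suc l. B ^ i) \<le> 2 * B ^ Suc l" by simp
    also have "\<dots> \<le> B * B ^ Suc l" using assms by (intro mult_right_mono) auto
    finally show ?case by simp
  qed
  then show ?thesis using card_lists_length_le[of "{..<B}" l] by simp
qed

text \<open>The nodes \<open>1, \<dots>, m\<close> get one child each, with the numbers of the children permuted. As the
  longest path from a node ends in its child, the queries \<open>(v, v)\<close> reveal the permutation, so
  that the memory contents for different permutations differ.\<close>

lemma fact_le_memories:
  fixes S t :: real
  assumes D: "\<And>T :: 'a ltree. is_ltree T \<Longrightarrow> nnodes T = n \<Longrightarrow>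
      \<exists>R. answers_queries B p R ({..<n} \<times> {..<n})
        (\<lambda>v1 v2 u1 u2. \<exists>xs. is_LCE_TT T v1 v2 xs u1 u2) S t"
    and m: "2 * m + 1 \<le> n" and B: "B \<le> B'" "2 \<le> B'"
  shows "fact m \<le> B' ^ Suc (nat \<lfloor>S\<rfloor>)"
proof -
  define L where "L = {m + 1..<2 * m + 1}"
  \<comment> \<open>Leaf \<open>m + 1 + j\<close> hangs below node \<open>1 + \<pi> j\<close>. All
    labels agree, so the argument works over every alphabet.\<close>
  define T :: "(nat \<Rightarrow> nat) \<Rightarrow> 'a ltree" where
    "T \<pi> = two_level n L (\<lambda>v. 1 + \<pi> (v - (m + 1))) (\<lambda>_. undefined)" for \<pi>
  let ?Perm = "{\<pi>. \<pi> permutes {..<m}}"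
  have lt: "\<pi> j < m" if "\<pi> \<in> ?Perm" "j < m" for \<pi> j
  proof -
    have "\<pi> j \<in> {..<m}" using that by (subst permutes_in_image) simp_all
    then show ?thesis by simp
  qed
  have tree: "is_ltree (T \<pi>)" if "\<pi> \<in> ?Perm" for \<pi>
    unfolding T_def
  proof (rule is_ltree_two_level)
    fix v assume "v \<in> L"
    then have "\<pi> (v - (m + 1)) < m" by (intro lt[OF that]) (auto simp: L_def)
    then show "1 + \<pi> (v - (m + 1)) \<in> {1..<n} - L" using m by (simp add: L_def)
  qed (use m in auto)
  have child: "is_child (T \<pi>) (1 + i) v \<longleftrightarrow> v \<in> L \<and> \<pi> (v - (m + 1)) = i" for \<pi> i v
  proof -
    have "v \<in> L \<Longrightarrow> 0 < v \<and> v < n" using m by (auto simp: L_def)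
    then show ?thesis unfolding T_def two_level_simps by (auto simp del: One_nat_def)
  qed
  have h1: "\<not> is_child (T \<pi>) v w" if "\<pi> \<in> ?Perm" "is_child (T \<pi>) (1 + i) v" for \<pi> i v w
  proof
    assume "is_child (T \<pi>) v w"
    then have vw: "v = (if w \<in> L then 1 + \<pi> (w - (m + 1)) else 0)"
      unfolding T_def two_level_simps by blast
    have v: "v \<in> L" using that(2) child by blast
    then have "v \<noteq> 0" by (simp add: L_def)
    with vw have w: "w \<in> L" by presburger
    then have "w - (m + 1) < m" by (auto simp: L_def)
    from lt[OF that(1) this] have "1 + \<pi> (w - (m + 1)) \<notin> L" by (simp add: L_def)
    with v vw w show False by metis
  qed
  have nn: "nnodes (T \<pi>) = n" for \<pi> by (simp add: T_def)
  define R where "R \<pi> = (SOME R. answers_queries B p R ({..<n} \<times> {..<n})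
    (\<lambda>v1 v2 u1 u2. \<exists>xs. is_LCE_TT (T \<pi>) v1 v2 xs u1 u2) S t)" for \<pi>
  have R: "answers_queries B p (R \<pi>) ({..<n} \<times> {..<n})
    (\<lambda>v1 v2 u1 u2. \<exists>xs. is_LCE_TT (T \<pi>) v1 v2 xs u1 u2) S t" if "\<pi> \<in> ?Perm" for \<pi>
    unfolding R_def by (rule someI_ex, rule D, rule tree[OF that], rule nn)
  define M where "M \<pi> = (SOME M. M \<in> R \<pi>)" for \<pi>
  have M: "M \<pi> \<in> R \<pi>" if "\<pi> \<in> ?Perm" for \<pi>
  proof -
    have "R \<pi> \<noteq> {}" using R[OF that] unfolding answers_queries_def by (rule conjunct1)
    then show ?thesis unfolding M_def by (rule some_in_eq[THEN iffD2])
  qed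
  have run: "\<exists>t rs M'. exec B p ((\<lambda>_. 0)(0 := 1 + \<pi> j, 1 := 1 + \<pi> j), M \<pi>) t (rs, M') \<and>
      rs 0 = m + 1 + j" if \<pi>: "\<pi> \<in> ?Perm" and j: "j < m" for \<pi> j
  proof -
    have "(1 + \<pi> j, 1 + \<pi> j) \<in> {..<n} \<times> {..<n}" using lt[OF that] m by auto
    from answers_queriesD[OF R[OF \<pi>] M[OF \<pi>] this] obtain t rs M' xs where
      e: "exec B p ((\<lambda>_. 0)(0 := 1 + \<pi> j, 1 := 1 + \<pi> j), M \<pi>) t (rs, M')"
        "is_LCE_TT (T \<pi>) (1 + \<pi> j) (1 + \<pi> j) xs (rs 0) (rs 1)"
      by blast
    have "is_child (T \<pi>) (1 + \<pi> j) (m + 1 + j)"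
      unfolding child using j by (simp add: L_def)
    then have "\<exists>a b. is_child (T \<pi>) (1 + \<pi> j) a \<and> is_child (T \<pi>) (1 + \<pi> j) b \<and>
        edge_label (T \<pi>) a = edge_label (T \<pi>) b" by blast
    with is_LCE_TT_height_1[OF e(2) h1[OF \<pi>, of "\<pi> j"] h1[OF \<pi>, of "\<pi> j"]]
    have "is_child (T \<pi>) (1 + \<pi> j) (rs 0)" by (simp only: if_True)
    then have u: "rs 0 \<in> L" "\<pi> (rs 0 - (m + 1)) = \<pi> j" unfolding child by blast+
    from \<pi> have "inj \<pi>" using permutes_inj by blast
    from injD[OF this u(2)] u(1) have "rs 0 = m + 1 + j" by (auto simp: L_def)
    with e(1) show ?thesis by blast
  qed
  have "inj_on M ?Perm"
  proof (rule inj_onI)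
    fix \<pi> \<pi>' assume p: "\<pi> \<in> ?Perm" "\<pi>' \<in> ?Perm" "M \<pi> = M \<pi>'"
    show "\<pi> = \<pi>'"
    proof
      fix j
      show "\<pi> j = \<pi>' j"
      proof (cases "j < m")
        case True
        \<comment> \<open>Under both permutations the query at node \<open>1 + \<pi> j\<close> runs
          on the same memory; it must return leaf \<open>m + 1 + j\<close> for the one and
          \<open>m + 1 + j'\<close> for the other.\<close>
        then obtain j' where j': "j' < m" "\<pi>' j' = \<pi> j"
          using p lt[OF p(1) True] permutes_image[of \<pi>' "{..<m}"]
          by (metis imageE lessThan_iff mem_Collect_eq)
        obtain t rs M1 where 1: "exec B p ((\<lambda>_. 0)(0 := 1 + \<pi> j, 1 := 1 + \<pi> j), M \<pi>) t (rs, M1)"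
          "rs 0 = m + 1 + j" using run[OF p(1) True] by blast
        obtain u rs' M2 where 2: "exec B p ((\<lambda>_. 0)(0 := 1 + \<pi> j, 1 := 1 + \<pi> j), M \<pi>) u (rs', M2)"
          "rs' 0 = m + 1 + j'" using run[OF p(2) j'(1)] unfolding j'(2) p(3) by blast
        from exec_deterministic[OF 1(1) 2(1)] 1(2) 2(2) have "j = j'" by simp
        with j' show ?thesis by simp
      next
        case False
        with p show ?thesis by (simp add: permutes_not_in)
      qed
    qed
  qed
  moreover have "M ` ?Perm \<subseteq> {xs. set xs \<subseteq> {..<B'} \<and> length xs \<le> nat \<lfloor>S\<rfloor>}"
  proof
    fix xs assume "xs \<in> M ` ?Perm"
    then obtain \<pi> where "\<pi> \<in> ?Perm" "xs = M \<pi>" by blast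
    then have "real (length xs) \<le> S" "\<forall>x\<in>set xs. x < B"
      using R[of \<pi>] M[of \<pi>] unfolding answers_queries_def by blast+
    then show "xs \<in> {xs. set xs \<subseteq> {..<B'} \<and> length xs \<le> nat \<lfloor>S\<rfloor>}" using B
      by (auto simp: le_nat_iff le_floor_iff)
  qed
  moreover have "finite {xs. set xs \<subseteq> {..<B'} \<and> length xs \<le> nat \<lfloor>S\<rfloor>}"
    by (intro finite_lists_length_le) auto
  ultimately have "card ?Perm \<le> card {xs. set xs \<subseteq> {..<B'} \<and> length xs \<le> nat \<lfloor>S\<rfloor>}"
    by (rule card_inj_on_le)
  also have "\<dots> \<le> B' ^ Suc (nat \<lfloor>S\<rfloor>)" using card_bounded_lists_le[OF B(2)] .
  finally show ?thesis by (simp only: card_permutations[OF card_lessThan finite_lessThan])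
qed

text \<open>Both the number of trees and the number of memory contents are compared with powers of
  the same base \<open>a\<close>, about \<open>n / 8\<close>. Since
  \<open>n + 2 \<le> a ^ 2\<close>, comparing exponents cancels the logarithms and leaves a linear
  bound.\<close>

lemma LCE_space_lower_bound:
  fixes S t :: real
  assumes D: "\<And>T :: 'a ltree. is_ltree T \<Longrightarrow> nnodes T = n \<Longrightarrow>
      \<exists>R. answers_queries (word_bound d n) p R ({..<n} \<times> {..<n})
        (\<lambda>v1 v2 u1 u2. \<exists>xs. is_LCE_TT T v1 v2 xs u1 u2) S t"
    and n: "72 \<le> n" and S: "0 \<le> S"
  shows "real n \<le> 18 * (real d + 1) * (S + 1)"
proof -
  \<comment> \<open>\<open>72 \<le> n\<close> gives \<open>9 \<le> a\<close>, hence
    \<open>n + 2 \<le> 8 * a + 9 \<le> 9 * a \<le> a ^ 2\<close>. The counting lemma is applied to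
    \<open>a + a\<close> inner nodes.\<close>
  define a l where "a = n div 8" "l = nat \<lfloor>S\<rfloor>"
  have a: "9 \<le> a" "n \<le> 8 * a + 7" "2 * (a + a) + 1 \<le> n" using n by (auto simp: a_l_def)
  have "9 * a \<le> a * a" using a(1) by (intro mult_right_mono) auto
  then have na: "n + 2 \<le> a ^ 2" using a(1,2) unfolding power2_eq_square by linarith
  have "a ^ a \<le> fact (a + a)" by (rule power_le_fact)
  also have "\<dots> \<le> ((n + 2) ^ Suc d) ^ Suc l" unfolding a_l_def(2)
  proof (rule fact_le_memories[OF D a(3)])
    \<comment> \<open>For \<open>d = 0\<close> the word bound is 1, but the count of lists needs a
      base of at least 2; hence the exponent \<open>Suc d\<close>.\<close>
    show "word_bound d n \<le> (n + 2) ^ Suc d" by (simp add: word_bound_def)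
    show "2 \<le> (n + 2) ^ Suc d" using self_le_power[of "n + 2" "Suc d"] by linarith
  qed
  also have "\<dots> = (n + 2) ^ (Suc d * Suc l)" by (rule power_mult[symmetric])
  also have "\<dots> \<le> (a ^ 2) ^ (Suc d * Suc l)" using na by (intro power_mono) auto
  also have "\<dots> = a ^ (2 * (Suc d * Suc l))" by (rule power_mult[symmetric])
  finally have "a \<le> 2 * (Suc d * Suc l)" using a(1) by (subst (asm) power_increasing_iff) auto
  then have "n \<le> 18 * (Suc d * Suc l)" using a by linarith
  then have "real n \<le> real (18 * (Suc d * Suc l))" by (rule of_nat_mono)
  also have "\<dots> = 18 * (real d + 1) * (real l + 1)" by (simp add: algebra_simps)
  also have "\<dots> \<le> 18 * (real d + 1) * (S + 1)"
    using S by (intro mult_left_mono) (auto simp: a_l_def)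
  finally show ?thesis .
qed

section \<open>The reduction\<close>

text \<open>Enumerate \<open>E\<close> and cut the numbers into blocks of length \<open>m\<close>;
  if \<open>m = 0\<close>, then \<open>E\<close> is empty.\<close>

lemma ex_balanced_partition:
  assumes "finite E" "card E \<le> K * m"
  shows "\<exists>part. (\<forall>e\<in>E. part e < K) \<and> (\<forall>r. card {e \<in> E. part e = r} \<le> m)"
proof -
  obtain f where f: "bij_betw f E {0..<card E}" using ex_bij_betw_finite_nat[OF assms(1)] by auto
  show ?thesis
  proof (intro exI[of _ "\<lambda>e. f e div m"] conjI ballI allI)
    fix e assume "e \<in> E"
    then have "f e < K * m" using bij_betwE[OF f] assms(2) by fastforce
    then show "f e div m < K" by (rule less_mult_imp_div_less)
  next
    fix r
    have m: "0 < m" if "e \<in> E" for e using assms that by (cases m) auto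
    have "f ` {e \<in> E. f e div m = r} \<subseteq> {r * m..<r * m + m}"
      using m dividend_less_div_times[of m] by (auto simp: add.commute)
    moreover have "inj_on f {e \<in> E. f e div m = r}"
      using f by (auto simp: bij_betw_def inj_on_def)
    ultimately have "card {e \<in> E. f e div m = r} \<le> card {r * m..<r * m + m}"
      by (intro card_inj_on_le) auto
    then show "card {e \<in> E. f e div m = r} \<le> m" by simp
  qed
qed

text \<open>One exponent has to serve all \<open>n\<close>, including 0. As the base is at least 2,
  a constant factor \<open>C\<close> is absorbed by \<open>C < 2 ^ C\<close>, and
  \<open>n + 8\<close> is at most the cube of \<open>n + 2\<close>.\<close>

lemma ex_word_bound_greater: "\<exists>D. \<forall>n. a * n + b + e * (n + 8) ^ d < word_bound D n"
proof (intro exI[of _ "a + b + e + (3 * d + 1)"] allI)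
  fix n :: nat
  define x where "x = n + 2"
  have x: "2 \<le> x" by (simp add: x_def)
  have "n + 8 \<le> x ^ 3" by (simp add: x_def power3_eq_cube algebra_simps)
  then have "(n + 8) ^ d \<le> x ^ (3 * d)" by (simp add: power_mult power_mono)
  also have "\<dots> \<le> x ^ (3 * d + 1)" using x by (intro power_increasing) auto
  finally have 1: "(n + 8) ^ d \<le> x ^ (3 * d + 1)" .
  have 2: "n \<le> x ^ (3 * d + 1)" using x self_le_power[of x "3 * d + 1"] by (auto simp: x_def)
  have 3: "1 \<le> x ^ (3 * d + 1)" using x by (intro one_le_power) auto
  have "a * n + b + e * (n + 8) ^ d \<le> a * x ^ (3 * d + 1) + b * x ^ (3 * d + 1) + e * x ^ (3 * d + 1)"
    using mult_le_mono2[OF 1, of e] mult_le_mono2[OF 2, of a] mult_le_mono2[OF 3, of b] by linarith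
  also have "\<dots> = (a + b + e) * x ^ (3 * d + 1)" by (simp add: algebra_simps)
  also have "\<dots> < 2 ^ (a + b + e) * x ^ (3 * d + 1)"
    using x by (intro mult_strict_right_mono) auto
  also have "\<dots> \<le> x ^ (a + b + e) * x ^ (3 * d + 1)"
    using x by (intro mult_right_mono power_mono) auto
  finally show "a * n + b + e * (n + 8) ^ d < word_bound (a + b + e + (3 * d + 1)) n"
    by (simp only: power_add word_bound_def x_def)
qed

text \<open>The incidences are cut into \<open>K\<close> parts, small enough for the trees of any two of the parts to
  have \<open>n\<close> nodes together.\<close>

lemma ex_pairwise_trees:
  fixes F :: "'a set list"
  assumes fin: "\<forall>S\<in>set F. finite S" and card: "(\<Sum>S\<leftarrow>F. card S) \<le> K * m" and n: "2 + 4 * m \<le> n"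
  shows "\<exists>(T :: nat \<Rightarrow> 'a ltree) f g P.
    (\<forall>r < K * K. is_ltree (T r) \<and> nnodes (T r) = n \<and> (\<forall>i. f r i < n \<and> g r i < n) \<and>
      (\<forall>i j xs u1 u2. is_LCE_TT (T r) (f r i) (g r j) xs u1 u2 \<longrightarrow> (u1 = f r i \<longleftrightarrow> P r i j))) \<and>
    (\<forall>i < length F. \<forall>j < length F. (\<forall>r < K * K. P r i j) \<longleftrightarrow> F ! i \<inter> F ! j = {})"
proof -
  define E where "E = Sigma {..<length F} (\<lambda>i. F ! i)"
  have finE: "finite E" using fin by (auto simp: E_def)
  have "card E = (\<Sum>S\<leftarrow>F. card S)"
    using fin by (simp add: E_def sum_list_sum_nth atLeast0LessThan)
  then obtain part where part: "\<And>e. e \<in> E \<Longrightarrow> part e < K" "\<And>r. card {e \<in> E. part e = r} \<le> m"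
    using ex_balanced_partition[OF finE, of K m] card by auto
  \<comment> \<open>\<open>r\<close> encodes an ordered pair of parts in base \<open>K\<close>. The
    tag gives a set separate keys for its roles as first and second argument, so the tree compares
    exactly these two parts, also when they coincide.\<close>
  define A where "A r = (\<lambda>(i, x). ((False, i), x)) ` {e \<in> E. part e = r div K} \<union>
     (\<lambda>(i, x). ((True, i), x)) ` {e \<in> E. part e = r mod K}" for r
  have A_mem: "((False, i), x) \<in> A r \<longleftrightarrow> (i, x) \<in> E \<and> part (i, x) = r div K"
    "((True, i), x) \<in> A r \<longleftrightarrow> (i, x) \<in> E \<and> part (i, x) = r mod K" for i x r
    by (auto simp: A_def image_iff)
  have finA: "finite (A r)" for r using finE by (auto simp: A_def)
  have "card (A r) \<le> m + m" for r
    unfolding A_def using finE part(2)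
    by (intro card_Un_le[THEN order_trans] add_mono card_image_le[THEN order_trans]) auto
  then have "2 + 2 * card (A r) \<le> 2 + 4 * m" for r
    using mult_le_mono2[of "card (A r)" "m + m" 2] by simp
  then have "2 + 2 * card (A r) \<le> n" for r using n order_trans by blast
  then have "\<exists>(T :: 'a ltree) h. is_ltree T \<and> nnodes T = n \<and> (\<forall>k. h k < n) \<and>
    (\<forall>k l xs u1 u2. is_LCE_TT T (h k) (h l) xs u1 u2 \<longrightarrow>
      (u1 = h k \<longleftrightarrow> \<not> (\<exists>x. (k, x) \<in> A r \<and> (l, x) \<in> A r)))" for r
    using ex_incidence_tree[OF finA] by blast
  then obtain T :: "nat \<Rightarrow> 'a ltree" and h where
    T: "\<And>r. is_ltree (T r) \<and> nnodes (T r) = n \<and> (\<forall>k. h r k < n) \<and>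
      (\<forall>k l xs u1 u2. is_LCE_TT (T r) (h r k) (h r l) xs u1 u2 \<longrightarrow>
      (u1 = h r k \<longleftrightarrow> \<not> (\<exists>x. (k, x) \<in> A r \<and> (l, x) \<in> A r)))"
    by metis
  define P where "P r i j \<longleftrightarrow> \<not> (\<exists>x. ((False, i), x) \<in> A r \<and> ((True, j), x) \<in> A r)" for r i j
  have "(\<forall>r < K * K. P r i j) \<longleftrightarrow> F ! i \<inter> F ! j = {}" if "i < length F" "j < length F" for i j
  proof
    assume *: "\<forall>r < K * K. P r i j"
    show "F ! i \<inter> F ! j = {}"
    proof (rule ccontr)
      assume "F ! i \<inter> F ! j \<noteq> {}"
      then obtain x where "x \<in> F ! i" "x \<in> F ! j" by auto
      then have E: "(i, x) \<in> E" "(j, x) \<in> E" using that by (auto simp: E_def)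
      \<comment> \<open>The tree that contains the incidence of \<open>x\<close> with
        \<open>i\<close> on the first side and with \<open>j\<close> on the second.\<close>
      define r where "r = part (i, x) * K + part (j, x)"
      have "r div K = part (i, x)" "r mod K = part (j, x)" using part(1)[OF E(2)] by (auto simp: r_def)
      moreover have "r < K * K"
      proof -
        have "r < Suc (part (i, x)) * K" using part(1)[OF E(2)] by (simp add: r_def)
        also have "\<dots> \<le> K * K" using part(1)[OF E(1)] by (intro mult_right_mono) auto
        finally show ?thesis .
      qed
      then have "P r i j" using * by blast
      ultimately show False unfolding P_def A_mem using E by metis
    qed
  next
    assume "F ! i \<inter> F ! j = {}"
    then show "\<forall>r < K * K. P r i j" by (auto simp: P_def A_mem E_def)
  qed
  then show ?thesis using T
    by (intro exI[of _ T] exI[of _ "\<lambda>r i. h r (False, i)"] exI[of _ "\<lambda>r i. h r (True, i)"] exI[of _ P])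
      (simp add: P_def)
qed

theorem theorem4:
  fixes s q :: "nat \<Rightarrow> real"
  assumes "LCE_TT_data_structure TYPE('a) s q"
  shows "\<forall>c. \<exists>s' q'. s' \<in> O(s) \<and> q' \<in> O(q) \<and> set_intersection_data_structure TYPE('a) c s' q'"
proof
  fix c :: nat
  obtain p d where D: "\<And>n T. is_ltree (T :: 'a ltree) \<Longrightarrow> nnodes T = n \<Longrightarrow>
      \<exists>R. answers_queries (word_bound d n) p R ({..<n} \<times> {..<n})
        (\<lambda>v1 v2 u1 u2. \<exists>xs. is_LCE_TT T v1 v2 xs u1 u2) (s n) (q n)"
    using assms unfolding LCE_TT_data_structure_def by blast
  \<comment> \<open>A star with \<open>n\<close> nodes serves as sample input. For
    \<open>n = 0\<close> there is no tree, so nothing is known about \<open>s 0\<close> and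
    \<open>q 0\<close>.\<close>
  have s_nonneg: "0 \<le> s n" and q_ge_1: "1 \<le> q n" if "0 < n" for n
  proof -
    let ?T = "two_level n {} id (\<lambda>_. undefined) :: 'a ltree"
    have "is_ltree ?T" using that by (intro is_ltree_two_level) simp_all
    from D[OF this two_level_simps(1)] obtain R where
      R: "answers_queries (word_bound d n) p R ({..<n} \<times> {..<n})
        (\<lambda>v1 v2 u1 u2. \<exists>xs. is_LCE_TT ?T v1 v2 xs u1 u2) (s n) (q n)" by (elim exE)
    from answers_queries_space_nonneg[OF R] show "0 \<le> s n" .
    from answers_queries_time_ge_1[OF R, of 0 0] that show "1 \<le> q n" by simp
  qed
  obtain b0 where "\<forall>x\<in>regs p. x < b0"
    using finite_regs finite_nat_set_iff_bounded by blast
  \<comment> \<open>Registers 0 and 1 must lie below \<open>b\<close> even if \<open>p\<close> does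
    not mention them, as they carry its queries and answers.\<close>
  then obtain b where b: "regs p \<subseteq> {..<b}" "2 \<le> b"
    by (intro that[of "max b0 2"]) auto
  \<comment> \<open>Trees with at least 6 nodes admit parts of size \<open>n1 n div 6 \<ge> n / 12\<close>.\<close>
  define K where "K = 12 * c"
  define k where "k = K * K"
  define n1 :: "nat \<Rightarrow> nat" where "n1 n = max n 6" for n
  define s' where "s' n = real (c * n * (3 * k)) + real k * s (n1 n)" for n
  define q' where "q' n = 6 + real k * (real b + 23 + 2 * q (n1 n))" for n
  have "s' \<in> O(s)"
  proof (rule bigoI, rule eventually_mono[OF eventually_ge_at_top[of "max 72 (36 * Suc d)"]])
    fix n assume n: "max 72 (36 * Suc d) \<le> n"
    then have n1: "n1 n = n" by (simp add: n1_def)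
    have s0: "0 \<le> s n" using n by (intro s_nonneg) auto
    have "real n \<le> 18 * (real d + 1) * (s n + 1)"
      using n s0 by (intro LCE_space_lower_bound[OF D]) auto
    \<comment> \<open>Absorbs the \<open>+ 1\<close> of the space bound:
      \<open>18 * (real d + 1)\<close> is at most half of \<open>n\<close>.\<close>
    moreover have "36 * (real d + 1) \<le> real n"
    proof -
      have "real (36 * Suc d) \<le> real n" using n by (intro of_nat_mono) simp
      then show ?thesis by simp
    qed
    ultimately have "real n \<le> 36 * (real d + 1) * s n" by (simp add: algebra_simps)
    then have "real (c * (3 * k)) * real n \<le> real (c * (3 * k)) * (36 * (real d + 1) * s n)"
      by (intro mult_left_mono) auto
    then have "s' n \<le> (real (c * (3 * k)) * (36 * (real d + 1)) + real k) * s n"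
      by (simp add: s'_def n1 algebra_simps)
    moreover have "0 \<le> s' n" using s0 by (simp add: s'_def n1)
    ultimately show "norm (s' n) \<le> (real (c * (3 * k)) * (36 * (real d + 1)) + real k) * norm (s n)"
      using s0 by simp
  qed
  moreover have "q' \<in> O(q)"
  proof (rule bigoI, rule eventually_mono[OF eventually_ge_at_top[of 6]])
    fix n :: nat assume n: "6 \<le> n"
    then have n1: "n1 n = n" by (simp add: n1_def)
    have q1: "1 \<le> q n" using n by (intro q_ge_1) auto
    have "real b + 23 + 2 * q n \<le> (real b + 25) * q n"
      using mult_left_mono[OF q1, of "real b + 23"] by (simp add: algebra_simps)
    then have "real k * (real b + 23 + 2 * q n) \<le> real k * ((real b + 25) * q n)"
      by (intro mult_left_mono) auto
    then have "q' n \<le> (6 + real k * (real b + 25)) * q n"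
      using q1 by (simp add: q'_def n1 algebra_simps)
    moreover have "0 \<le> q' n" using q1 by (simp add: q'_def n1)
    ultimately show "norm (q' n) \<le> (6 + real k * (real b + 25)) * norm (q n)" using q1 by simp
  qed
  moreover have "set_intersection_data_structure TYPE('a) c s' q'"
  proof -
    \<comment> \<open>Chosen before \<open>n\<close> and \<open>F\<close>. The summands pay for the
      table, the row numbers, the \<open>k\<close> memories and \<open>B\<close> itself, where
      \<open>n1 n + 2 \<le> n + 8\<close>.\<close>
    obtain d' where d': "\<And>n. (c * (3 * k) + c + 1) * n + (3 * k + 7) + (k + 1) * (n + 8) ^ d
        < word_bound d' n"
      using ex_word_bound_greater by meson
    have "\<exists>R. answers_queries (word_bound d' n) (all_subqueries b k p) R
        ({..<length F} \<times> {..<length F}) (\<lambda>i j x _. x = of_bool (F ! i \<inter> F ! j = {})) (s' n) (q' n)"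
      if F: "\<forall>S\<in>set F. finite S" "(\<Sum>S\<leftarrow>F. card S) \<le> c * n" "length F \<le> c * n"
      for n and F :: "'a set list"
    proof -
      define m where "m = n1 n div 6"
      \<comment> \<open>\<open>m\<close> is positive, so
        \<open>2 + 4 * m \<le> 6 * m \<le> n1 n\<close> and
        \<open>n < 6 * (m + 1) \<le> 12 * m\<close>.\<close>
      have m: "2 + 4 * m \<le> n1 n" "n \<le> 12 * m"
        unfolding m_def n1_def max_def by presburger+
      note F(2)
      also have "c * n \<le> c * (12 * m)" using m(2) by (rule mult_le_mono2)
      also have "\<dots> = K * m" by (simp add: K_def)
      finally have "(\<Sum>S\<leftarrow>F. card S) \<le> K * m" .
      from ex_pairwise_trees[OF F(1) this m(1), folded k_def]
      obtain T :: "nat \<Rightarrow> 'a ltree" and f g P where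
        T: "(\<forall>r < k. is_ltree (T r) \<and> nnodes (T r) = n1 n \<and> (\<forall>i. f r i < n1 n \<and> g r i < n1 n) \<and>
          (\<forall>i j xs u1 u2. is_LCE_TT (T r) (f r i) (g r j) xs u1 u2 \<longrightarrow> (u1 = f r i \<longleftrightarrow> P r i j))) \<and>
          (\<forall>i < length F. \<forall>j < length F. (\<forall>r < k. P r i j) \<longleftrightarrow> F ! i \<inter> F ! j = {})"
        by (elim exE)
      have T_range: "f r i < n1 n" "g r i < n1 n"
        and T_ans: "is_LCE_TT (T r) (f r i) (g r j) xs x y \<Longrightarrow> x = f r i \<longleftrightarrow> P r i j"
        if "r < k" for r i j xs x y
        using mp[OF spec[OF conjunct1[OF T]] that] by blast+
      have T_inter: "(\<forall>r < k. P r i j) \<longleftrightarrow> F ! i \<inter> F ! j = {}"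
        if "i < length F" "j < length F" for i j
        using conjunct2[OF T] that by blast
      define B where "B = word_bound d (n1 n)"
      have "\<forall>r<k. \<exists>R. answers_queries B p R ({..<n1 n} \<times> {..<n1 n})
          (\<lambda>v1 v2 u1 u2. \<exists>xs. is_LCE_TT (T r) v1 v2 xs u1 u2) (s (n1 n)) (q (n1 n))"
        unfolding B_def using conjunct1[OF T] by (intro allI impI D) simp_all
      then obtain R where R: "\<And>r. r < k \<Longrightarrow> answers_queries B p (R r) ({..<n1 n} \<times> {..<n1 n})
          (\<lambda>v1 v2 u1 u2. \<exists>xs. is_LCE_TT (T r) v1 v2 xs u1 u2) (s (n1 n)) (q (n1 n))"
        by metis
      have B: "B \<le> (n + 8) ^ d" unfolding B_def word_bound_def n1_def by (intro power_mono) auto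
      have lenF: "length F * (3 * k) \<le> c * n * (3 * k)" using F(3) by (rule mult_le_mono1)
      have "(c * (3 * k) + c + 1) * n + (3 * k + 7) + (k + 1) * (n + 8) ^ d =
          c * n * (3 * k) + c * n + n + 3 * k + 7 + k * (n + 8) ^ d + (n + 8) ^ d"
        by (simp add: algebra_simps)
      moreover have "n1 n \<le> n + 6" by (simp add: n1_def)
      moreover note d'[of n] B lenF F(3) mult_le_mono2[OF B, of k]
      ultimately
      have B': "length F * (3 * k) + k * B + 3 * k + length F + 1 < word_bound d' n"
        "B \<le> word_bound d' n" "n1 n \<le> word_bound d' n"
        by linarith+
      have "\<exists>R'. answers_queries (word_bound d' n) (all_subqueries b k p) R'
          ({..<length F} \<times> {..<length F}) (\<lambda>i j x _. x = of_bool (\<forall>r<k. P r i j))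
          (real (length F * (3 * k)) + real k * s (n1 n)) (q' n)"
        unfolding q'_def
      proof (rule answers_queries_conjunction[where f = f and g = g and B = B and R = R
            and Q = "{..<n1 n} \<times> {..<n1 n}"
            and ans = "\<lambda>r v1 v2 u1 u2. \<exists>xs. is_LCE_TT (T r) v1 v2 xs u1 u2"])
        show "(f r i, g r j) \<in> {..<n1 n} \<times> {..<n1 n}" if "r < k" for r i j
          using T_range[OF that] by simp
        show "x = f r i \<longleftrightarrow> P r i j"
          if "r < k" "\<exists>xs. is_LCE_TT (T r) (f r i) (g r j) xs x y" for r i j x y
        proof -
          from that(2) obtain xs where "is_LCE_TT (T r) (f r i) (g r j) xs x y" ..
          from T_ans[OF that(1) this] show ?thesis .
        qed
        show "f r i < word_bound d' n \<and> g r i < word_bound d' n" if "r < k" for r i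
          using T_range[OF that, of i] B'(3) by simp
      qed (use b R B' in simp_all)
      then obtain R' where R': "answers_queries (word_bound d' n) (all_subqueries b k p) R'
          ({..<length F} \<times> {..<length F}) (\<lambda>i j x _. x = of_bool (\<forall>r<k. P r i j))
          (real (length F * (3 * k)) + real k * s (n1 n)) (q' n)" by (elim exE)
      have "answers_queries (word_bound d' n) (all_subqueries b k p) R'
          ({..<length F} \<times> {..<length F}) (\<lambda>i j x _. x = of_bool (F ! i \<inter> F ! j = {})) (s' n) (q' n)"
      proof (rule answers_queries_weaken[OF R'])
        show "real (length F * (3 * k)) + real k * s (n1 n) \<le> s' n"
          unfolding s'_def using of_nat_mono[OF lenF] by (intro add_right_mono)
        show "x = of_bool (F ! i \<inter> F ! j = {})"
          if "(i, j) \<in> {..<length F} \<times> {..<length F}" "x = of_bool (\<forall>r<k. P r i j)" for i j x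
          using T_inter[of i j] that by simp
      qed simp
      then show ?thesis by blast
    qed
    then show ?thesis unfolding set_intersection_data_structure_def by blast
  qed
  ultimately show "\<exists>s' q'. s' \<in> O(s) \<and> q' \<in> O(q) \<and> set_intersection_data_structure TYPE('a) c s' q'"
    by blast
qed

end
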